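(* Every perfect finite-dimensional strategy $(\rho,M,N)$ for $G_5$ (that is, one with $\omega(G_5;\rho,M,N)=1$) satisfies, for all $x\in\{0,1,2,3\}$, $y\in\{0,1,2\}$, $a,b\in\{0,\dots,4\}$, $$\mathrm{Tr}\bigl[\rho(M_{a|x}\otimes N_{b|y})\bigr]=p_\star(a,b|x,y),\qquad\text{where}\qquad p_\star(a,b|x,y)=\frac{|u_{xa}^{\mathsf T}Dv_{yb}|^2}{17}.$$
   Context: **The game $G_5$.** Let $e_0,\dots,e_4$ be the standard basis of $\mathbb R^5$ and $D=\mathrm{diag}(2,2,2,2,1)$. Put $c_0=(-e_0-e_1-e_2+e_3)/2$, $c_1=(e_0+e_1-e_2+e_3)/2$, $h=(-e_0+e_1-e_2-e_3)/2$, $h'=(e_0-e_1-e_2-e_3)/2$, $d_0=(-e_0+e_1-e_2+e_3)/2$, $d_1=(e_0+e_1+e_2+e_3)/2$, $k=(e_0+e_1-e_2-e_3)/2$, $k'=(-e_0+e_1+e_2-e_3)/2$. For $x\in\{0,1,2,3\}$ and $a\in\{0,\dots,4\}$ let $u_{xa}$ be the normalization (to unit length) of the $a$-th vector of row $x$: row 0: $(e_0-e_1,\ e_0+e_1,\ e_2-e_3,\ e_2+e_3,\ e_4)$; row 1: $(e_4,\ e_0-e_2,\ e_0+e_2,\ e_1-e_3,\ e_1+e_3)$; row 2: $(e_1-e_2,\ e_1+e_2,\ e_0-e_4,\ e_0+e_4,\ e_3)$; row 3: $(e_0-e_3,\ e_0+e_3,\ e_2-e_4,\ e_2+e_4,\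 e_1)$. For $y\in\{0,1,2\}$ and $b\in\{0,\dots,4\}$ let $v_{yb}$ be the normalization of the $b$-th vector of row $y$: row 0: $(e_0,e_1,e_2,e_3,e_4)$; row 1: $(c_0,\ c_1,\ h+e_4,\ h-e_4,\ h')$; row 2: $(d_0,\ d_1,\ k+e_4,\ k-e_4,\ k')$. Each of the 12 question pairs $(x,y)$ (Alice gets $x$, Bob gets $y$) has probability $1/12$; answers are $a,b\in\{0,\dots,4\}$; the winning predicate is $\mathsf w(x,y,a,b)=1$ if $u_{xa}^{\mathsf T}Dv_{yb}\neq0$ and $0$ otherwise. **Strategies.** A (finite-dimensional) quantum strategy consists of finite-dimensional complex Hilbert spaces $\mathcal H_A,\mathcal H_B$, a density operator $\rho$ on $\mathcal H_A\otimes\mathcal H_B$, and POVMs $\{M_{a|x}\}_{a=0}^4$ on $\mathcal H_A$ for each $x$ and $\{N_{b|y}\}_{b=0}^4$ on $\mathcal H_B$ for each $y$. Its winning probability is $\omega(G_5;\rho,M,N)=\frac1{12}\sum_{x,y,a,b}\mathsf w(x,y,a,b)\,\mathrm{Tr}[\rho(M_{a|x}\otimes N_{b|y})]$. *)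

theory Defs
  imports "HOL-Analysis.Analysis" "HOL-Library.Numeral_Type"
begin

section \<open>Vectors of the game\<close>

text \<open>The coordinates of \<open>\<real>\<^sup>5\<close> are indexed by the five-element type \<^typ>\<open>5\<close>, whose elements are
  \<open>0, 1, 2, 3, 4\<close> (arithmetic modulo 5); questions and answers are natural numbers.\<close>

definition e :: "5 \<Rightarrow> real ^ 5" where
  "e i = axis i 1"

definition D :: "real ^ 5 ^ 5" where
  "D = (\<chi> i j. if i = j then (if i = 4 then 1 else 2) else 0)"

definition vec_c0 :: "real ^ 5" where "vec_c0 = (- e 0 - e 1 - e 2 + e 3) /\<^sub>R 2"
definition vec_c1 :: "real ^ 5" where "vec_c1 = (e 0 + e 1 - e 2 + e 3) /\<^sub>R 2"
definition vec_h :: "real ^ 5" where "vec_h = (- e 0 + e 1 - e 2 - e 3) /\<^sub>R 2"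
definition vec_h' :: "real ^ 5" where "vec_h' = (e 0 - e 1 - e 2 - e 3) /\<^sub>R 2"
definition vec_d0 :: "real ^ 5" where "vec_d0 = (- e 0 + e 1 - e 2 + e 3) /\<^sub>R 2"
definition vec_d1 :: "real ^ 5" where "vec_d1 = (e 0 + e 1 + e 2 + e 3) /\<^sub>R 2"
definition vec_k :: "real ^ 5" where "vec_k = (e 0 + e 1 - e 2 - e 3) /\<^sub>R 2"
definition vec_k' :: "real ^ 5" where "vec_k' = (- e 0 + e 1 + e 2 - e 3) /\<^sub>R 2"

definition u_rows :: "(real ^ 5) list list" where
  "u_rows =
    [[e 0 - e 1, e 0 + e 1, e 2 - e 3, e 2 + e 3, e 4],
     [e 4, e 0 - e 2, e 0 + e 2, e 1 - e 3, e 1 + e 3],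
     [e 1 - e 2, e 1 + e 2, e 0 - e 4, e 0 + e 4, e 3],
     [e 0 - e 3, e 0 + e 3, e 2 - e 4, e 2 + e 4, e 1]]"

definition v_rows :: "(real ^ 5) list list" where
  "v_rows =
    [[e 0, e 1, e 2, e 3, e 4],
     [vec_c0, vec_c1, vec_h + e 4, vec_h - e 4, vec_h'],
     [vec_d0, vec_d1, vec_k + e 4, vec_k - e 4, vec_k']]"

text \<open>Recall that \<^term>\<open>sgn w\<close> is \<open>w\<close> scaled to unit length. Only \<open>x < 4\<close>, \<open>y < 3\<close> and
  \<open>a, b < 5\<close> are meaningful below.\<close>

definition u :: "nat \<Rightarrow> nat \<Rightarrow> real ^ 5" where
  "u x a = sgn (u_rows ! x ! a)"

definition v :: "nat \<Rightarrow> nat \<Rightarrow> real ^ 5" where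
  "v y b = sgn (v_rows ! y ! b)"

definition wins :: "nat \<Rightarrow> nat \<Rightarrow> nat \<Rightarrow> nat \<Rightarrow> bool" where
  "wins x y a b \<longleftrightarrow> u x a \<bullet> (D *v v y b) \<noteq> 0"

definition p_star :: "nat \<Rightarrow> nat \<Rightarrow> nat \<Rightarrow> nat \<Rightarrow> real" where
  "p_star a b x y = \<bar>u x a \<bullet> (D *v v y b)\<bar>\<^sup>2 / 17"


section \<open>Finite-dimensional quantum strategies\<close>

text \<open>The Hilbert spaces are \<open>\<complex>\<^sup>m\<close> and \<open>\<complex>\<^sup>n\<close>, with the index types \<open>'m\<close> and \<open>'n\<close> labelling
  orthonormal bases, and their tensor product is \<open>\<complex>\<^bsup>m \<times> n\<^esup>\<close>. Operators are square matrices.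
  The zero space is not covered, but it carries no density operator.\<close>

text \<open>On a complex space, a quadratic form with values in the nonnegative reals forces the
  operator to be Hermitian.\<close>

definition psd :: "complex ^ 'n ^ 'n \<Rightarrow> bool" where
  "psd A \<longleftrightarrow> (\<forall>w. (\<Sum>i\<in>UNIV. cnj (w $ i) * (A *v w) $ i) \<in> \<real>\<^sub>\<ge>\<^sub>0)"

definition density_operator :: "complex ^ 'n ^ 'n \<Rightarrow> bool" where
  "density_operator \<rho> \<longleftrightarrow> psd \<rho> \<and> trace \<rho> = 1"

definition povm5 :: "(nat \<Rightarrow> complex ^ 'n ^ 'n) \<Rightarrow> bool" where
  "povm5 E \<longleftrightarrow> (\<forall>a<5. psd (E a)) \<and> (\<Sum>a<5. E a) = mat 1"

definition tensor_op ::
  "complex ^ 'm ^ 'm \<Rightarrow> complex ^ 'n ^ 'n \<Rightarrow> complex ^ ('m \<times> 'n) ^ ('m \<times> 'n)" where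
  "tensor_op A B = (\<chi> i j. A $ fst i $ fst j * B $ snd i $ snd j)"

text \<open>\<open>M x a\<close> stands for \<open>M\<^bsub>a|x\<^esub>\<close>, and \<open>N y b\<close> for \<open>N\<^bsub>b|y\<^esub>\<close>.\<close>

definition quantum_strategy ::
  "complex ^ ('m \<times> 'n) ^ ('m \<times> 'n) \<Rightarrow> (nat \<Rightarrow> nat \<Rightarrow> complex ^ 'm ^ 'm) \<Rightarrow>
   (nat \<Rightarrow> nat \<Rightarrow> complex ^ 'n ^ 'n) \<Rightarrow> bool" where
  "quantum_strategy \<rho> M N \<longleftrightarrow>
     density_operator \<rho> \<and> (\<forall>x<4. povm5 (M x)) \<and> (\<forall>y<3. povm5 (N y))"

text \<open>The Born-rule probabilities are traces of complex matrices, so they and the winning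
  probability are typed as complex numbers; for a strategy their values are real.\<close>

definition correlation ::
  "complex ^ ('m \<times> 'n) ^ ('m \<times> 'n) \<Rightarrow> (nat \<Rightarrow> nat \<Rightarrow> complex ^ 'm ^ 'm) \<Rightarrow>
   (nat \<Rightarrow> nat \<Rightarrow> complex ^ 'n ^ 'n) \<Rightarrow> nat \<Rightarrow> nat \<Rightarrow> nat \<Rightarrow> nat \<Rightarrow> complex" where
  "correlation \<rho> M N a b x y = trace (\<rho> ** tensor_op (M x a) (N y b))"

definition winning_probability ::
  "complex ^ ('m \<times> 'n) ^ ('m \<times> 'n) \<Rightarrow> (nat \<Rightarrow> nat \<Rightarrow> complex ^ 'm ^ 'm) \<Rightarrow>
   (nat \<Rightarrow> nat \<Rightarrow> complex ^ 'n ^ 'n) \<Rightarrow> complex" where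
  "winning_probability \<rho> M N =
     1 / 12 * (\<Sum>x<4. \<Sum>y<3. \<Sum>a<5. \<Sum>b<5. of_bool (wins x y a b) * correlation \<rho> M N a b x y)"

end

theory Submission imports Defs
begin

text \<open>Write \<open>\<rho> = L L\<^sup>*\<close> and regard \<open>L\<close> as a vector \<open>\<psi>\<close> on which the measurement operators act by left
  multiplication. Perfectness says that \<open>A\<^bsub>xa\<^esub> B\<^bsub>yb\<^esub> \<psi> = 0\<close> for every losing pair, so each row of the game
  identifies sums of Alice's operators with sums of Bob's operators on \<open>\<psi>\<close>. Bob's question 0 supplies
  orthogonal projections \<open>\<beta>\<^sub>0, \<dots>, \<beta>\<^sub>4\<close>. His questions 1 and 2 each supply sign observables \<open>T\<^sub>i\<^sub>j\<close> for
  \<open>i, j < 4\<close>. The two families agree on the range of \<open>\<beta>\<^sub>j\<close>, but \<open>T\<^sub>k\<^sub>l = - T\<^sub>i\<^sub>j\<close> for one and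
  \<open>T\<^sub>k\<^sub>l = T\<^sub>i\<^sub>j\<close> for the other when \<open>{i,j,k,l} = {0,1,2,3}\<close>. As in the magic square, this parity clash forces
  \<open>T\<^sub>i\<^sub>j\<close> to map the range of \<open>\<beta>\<^sub>j\<close> to that of \<open>\<beta>\<^sub>i\<close>, which gives \<open>4 \<times> 4\<close> matrix
  units. The two answers \<open>h \<plusminus> e\<^sub>4\<close> (and \<open>k \<plusminus> e\<^sub>4\<close>), compared with Alice's \<open>e\<^sub>0 \<plusminus> e\<^sub>4\<close> and \<open>e\<^sub>2 \<plusminus> e\<^sub>4\<close>, extend them
  to \<open>5 \<times> 5\<close> matrix units and make the weight of \<open>\<beta>\<^sub>4\<close> a quarter of the other four weights. All
  measurement operators are then explicit combinations of matrix units on \<open>\<psi>\<close>, and the correlation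
  follows.\<close>

hide_const (open) u v e D

section \<open>Tables of the game\<close>

text \<open>\<open>uc\<close> holds Alice's unnormalised vectors, \<open>wc\<close> holds \<open>D\<close> times Bob's, and \<open>dd\<close> is the diagonal
  of \<open>D\<^sup>2\<close>.\<close>

definition uc :: "nat \<Rightarrow> nat \<Rightarrow> nat \<Rightarrow> real" where
  "uc x a i =
    [[[1,-1,0,0,0], [1,1,0,0,0], [0,0,1,-1,0], [0,0,1,1,0], [0,0,0,0,1]],
     [[0,0,0,0,1], [1,0,-1,0,0], [1,0,1,0,0], [0,1,0,-1,0], [0,1,0,1,0]],
     [[0,1,-1,0,0], [0,1,1,0,0], [1,0,0,0,-1], [1,0,0,0,1], [0,0,0,1,0]],
     [[1,0,0,-1,0], [1,0,0,1,0], [0,0,1,0,-1], [0,0,1,0,1], [0,1,0,0,0]]] ! x ! a ! i"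

definition wc :: "nat \<Rightarrow> nat \<Rightarrow> nat \<Rightarrow> real" where
  "wc y b i =
    [[[2,0,0,0,0], [0,2,0,0,0], [0,0,2,0,0], [0,0,0,2,0], [0,0,0,0,1]],
     [[-1,-1,-1,1,0], [1,1,-1,1,0], [-1,1,-1,-1,1], [-1,1,-1,-1,-1], [1,-1,-1,-1,0]],
     [[-1,1,-1,1,0], [1,1,1,1,0], [1,1,-1,-1,1], [1,1,-1,-1,-1], [-1,1,1,-1,0]]] ! y ! b ! i"

definition dd :: "nat \<Rightarrow> real" where
  "dd i = (if i = 4 then 1 else 4)"

lemma all_less_5: "(\<forall>a<5. P a) \<longleftrightarrow> P 0 \<and> P 1 \<and> P 2 \<and> P 3 \<and> P (4::nat)"
  by (simp add: numeral_eq_Suc All_less_Suc) blast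

lemma all_less_4: "(\<forall>a<4. P a) \<longleftrightarrow> P 0 \<and> P 1 \<and> P 2 \<and> P (3::nat)"
  by (simp add: numeral_eq_Suc All_less_Suc) blast

lemma all_less_3: "(\<forall>a<3. P a) \<longleftrightarrow> P 0 \<and> P 1 \<and> P (2::nat)"
  by (simp add: numeral_eq_Suc All_less_Suc) blast

lemma sum_less_5: "(\<Sum>i<5. f i) = f 0 + f 1 + f 2 + f 3 + f (4::nat)" for f :: "nat \<Rightarrow> 'a::comm_monoid_add"
  by (simp add: numeral_eq_Suc)

lemma sum_less_4: "(\<Sum>i<4. f i) = f 0 + f 1 + f 2 + f (3::nat)" for f :: "nat \<Rightarrow> 'a::comm_monoid_add"
  by (simp add: numeral_eq_Suc)

lemmas small_simps = all_less_5 all_less_4 all_less_3 sum_less_5 sum_less_4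

lemma less_5_cases: "(a::nat) < 5 \<Longrightarrow> a = 0 \<or> a = 1 \<or> a = 2 \<or> a = 3 \<or> a = 4"
  by auto

text \<open>\<open>(x,a,i,j)\<close> records that answers \<open>a\<close> and \<open>a + 1\<close> of row \<open>x\<close> carry \<open>e\<^sub>i - e\<^sub>j\<close> and \<open>e\<^sub>i + e\<^sub>j\<close>.\<close>

definition blocks :: "(nat \<times> nat \<times> nat \<times> nat) set" where
  "blocks = {(0,0,0,1), (0,2,2,3), (1,1,0,2), (1,3,1,3), (2,0,1,2), (2,2,0,4), (3,0,0,3), (3,2,2,4)}"

lemma block_range:
  assumes "(x,a,i,j) \<in> blocks"
  shows "x < 4" "a < 5" "Suc a < 5" "i < 5" "j < 5" "i \<noteq> j" "i < 4"
  using assms by (auto simp: blocks_def)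

lemma block_rows:
  assumes "(x,a,i,j) \<in> blocks"
  shows "\<forall>k<5. uc x a k = of_bool (k = i) - of_bool (k = j)"
    and "\<forall>k<5. uc x (Suc a) k = of_bool (k = i) + of_bool (k = j)"
    and "\<forall>a'<5. a' \<noteq> a \<longrightarrow> a' \<noteq> Suc a \<longrightarrow> uc x a' i = 0 \<and> uc x a' j = 0"
proof -
  have *: "\<forall>(x,a,i,j) \<in> blocks. (\<forall>k<5. uc x a k = of_bool (k = i) - of_bool (k = j)) \<and>
    (\<forall>k<5. uc x (Suc a) k = of_bool (k = i) + of_bool (k = j)) \<and>
    (\<forall>a'<5. a' \<noteq> a \<longrightarrow> a' \<noteq> Suc a \<longrightarrow> uc x a' i = 0 \<and> uc x a' j = 0)"
    unfolding blocks_def ball_simps prod.case all_less_5 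
    by (simp add: uc_def)
  show "\<forall>k<5. uc x a k = of_bool (k = i) - of_bool (k = j)"
    "\<forall>k<5. uc x (Suc a) k = of_bool (k = i) + of_bool (k = j)"
    "\<forall>a'<5. a' \<noteq> a \<longrightarrow> a' \<noteq> Suc a \<longrightarrow> uc x a' i = 0 \<and> uc x a' j = 0"
   using * assms by fast+
qed

lemma wc_0: "\<forall>k<5. \<forall>i<5. i \<noteq> k \<longrightarrow> wc 0 k i = 0"
  by (simp add: wc_def small_simps)

section \<open>Perfect strategies in the abstract: two commuting families of operators and a unit
  vector\<close>

locale perfect_game =
  fixes A B :: "nat \<Rightarrow> nat \<Rightarrow> 'v \<Rightarrow> 'v::real_inner" and \<psi> :: 'v
  assumes linA: "linear (A x a)" and linB: "linear (B y b)"
    and comm: "A x a (B y b v) = B y b (A x a v)"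
    and sumA: "x < 4 \<Longrightarrow> (\<Sum>a<5. A x a v) = v"
    and sumB: "y < 3 \<Longrightarrow> (\<Sum>b<5. B y b v) = v"
    and selfA: "x < 4 \<Longrightarrow> a < 5 \<Longrightarrow> inner (A x a v) w = inner v (A x a w)"
    and selfB: "y < 3 \<Longrightarrow> b < 5 \<Longrightarrow> inner (B y b v) w = inner v (B y b w)"
    and unit: "inner \<psi> \<psi> = 1"
    and lose: "x < 4 \<Longrightarrow> y < 3 \<Longrightarrow> a < 5 \<Longrightarrow> b < 5 \<Longrightarrow> (\<Sum>i<5. uc x a i * wc y b i) = 0
      \<Longrightarrow> A x a (B y b \<psi>) = 0"
begin

lemmas A_simps = linear_add[OF linA] linear_diff[OF linA] linear_scale[OF linA] linear_0[OF linA]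
  linear_neg[OF linA] linear_sum[OF linA]
lemmas B_simps = linear_add[OF linB] linear_diff[OF linB] linear_scale[OF linB] linear_0[OF linB]
  linear_neg[OF linB] linear_sum[OF linB]

text \<open>The commutant of Bob's operators. It contains Alice's operators and is closed under
  sums, scalings and compositions, so whatever is built from them can be moved past Bob.\<close>

definition Alice :: "('v \<Rightarrow> 'v) set" where
  "Alice = {X. linear X \<and> (\<forall>y b v. X (B y b v) = B y b (X v))}"

lemma Alice_linear: "X \<in> Alice \<Longrightarrow> linear X"
  by (simp add: Alice_def)

lemma Alice_comm: "X \<in> Alice \<Longrightarrow> B y b (X v) = X (B y b v)"
  by (simp add: Alice_def)

lemma Alice_simps:
  assumes "X \<in> Alice"
  shows "X (v + w) = X v + X w" "X (v - w) = X v - X w" "X (c *\<^sub>R v) = c *\<^sub>R X v" "X 0 = 0"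
    "X (- v) = - X v" "X (sum f I) = (\<Sum>i\<in>I. X (f i))"
  using Alice_linear[OF assms]
  by (simp_all add: linear_add linear_diff linear_scale linear_0 linear_neg linear_sum)

lemma AliceI:
  assumes "\<And>v w. X (v + w) = X v + X w" "\<And>c v. X (c *\<^sub>R v) = c *\<^sub>R X v"
    "\<And>y b v. X (B y b v) = B y b (X v)"
  shows "X \<in> Alice"
  using assms by (auto simp: Alice_def intro: linearI)

lemma Alice_A: "A x a \<in> Alice"
  by (rule AliceI) (simp_all add: A_simps comm)

lemma Alice_id: "(\<lambda>v. v) \<in> Alice"
  by (rule AliceI) simp_all

lemma Alice_0: "(\<lambda>v. 0) \<in> Alice"
  by (rule AliceI) (simp_all add: B_simps)

lemma Alice_add: "X \<in> Alice \<Longrightarrow> Y \<in> Alice \<Longrightarrow> (\<lambda>v. X v + Y v) \<in> Alice"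
  by (rule AliceI) (simp_all add: Alice_simps B_simps Alice_comm algebra_simps)

lemma Alice_diff: "X \<in> Alice \<Longrightarrow> Y \<in> Alice \<Longrightarrow> (\<lambda>v. X v - Y v) \<in> Alice"
  by (rule AliceI) (simp_all add: Alice_simps B_simps Alice_comm algebra_simps)

lemma Alice_scale: "X \<in> Alice \<Longrightarrow> (\<lambda>v. c *\<^sub>R X v) \<in> Alice"
  by (rule AliceI) (simp_all add: Alice_simps B_simps Alice_comm algebra_simps)

lemma Alice_comp: "X \<in> Alice \<Longrightarrow> Y \<in> Alice \<Longrightarrow> (\<lambda>v. X (Y v)) \<in> Alice"
  by (rule AliceI) (simp_all add: Alice_simps B_simps Alice_comm)

lemma Alice_sum:
  assumes "\<And>i. i \<in> I \<Longrightarrow> X i \<in> Alice"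
  shows "(\<lambda>v. \<Sum>i\<in>I. X i v) \<in> Alice"
  using assms
  by (induction I rule: infinite_finite_induct) (simp_all add: Alice_0 Alice_add)

text \<open>Since Bob's operators commute with \<open>Alice\<close>, an identity between them that holds on \<open>\<psi>\<close> holds
  on all of \<open>W\<close>.\<close>

definition W :: "'v set" where
  "W = (\<lambda>X. X \<psi>) ` Alice"

lemma W_psi: "\<psi> \<in> W"
  unfolding W_def using Alice_id by force

lemma W_I: "X \<in> Alice \<Longrightarrow> X \<psi> \<in> W"
  by (simp add: W_def)

lemma W_E: "w \<in> W \<Longrightarrow> (\<And>X. X \<in> Alice \<Longrightarrow> w = X \<psi> \<Longrightarrow> P) \<Longrightarrow> P"
  by (auto simp: W_def)

lemma W_Alice: "X \<in> Alice \<Longrightarrow> w \<in> W \<Longrightarrow> X w \<in> W"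
  by (metis Alice_comp W_E W_I)

lemma W_diff: "v \<in> W \<Longrightarrow> w \<in> W \<Longrightarrow> v - w \<in> W"
  by (metis (no_types, lifting) Alice_diff W_E W_I)

section \<open>Functions of Bob's outcomes\<close>

definition Bf :: "nat \<Rightarrow> (nat \<Rightarrow> real) \<Rightarrow> 'v \<Rightarrow> 'v" where
  "Bf y g v = (\<Sum>b<5. g b *\<^sub>R B y b v)"

lemma Bf_simps: "Bf y g (v + w) = Bf y g v + Bf y g w" "Bf y g (v - w) = Bf y g v - Bf y g w"
    "Bf y g (c *\<^sub>R v) = c *\<^sub>R Bf y g v" "Bf y g 0 = 0" "Bf y g (- v) = - Bf y g v"
  by (simp_all add: Bf_def B_simps sum.distrib sum_subtractf scaleR_right_distrib
      scaleR_right_diff_distrib scaleR_sum_right sum_negf mult.commute)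

lemma Bf_comm: "X \<in> Alice \<Longrightarrow> Bf y g (X v) = X (Bf y g v)"
  by (simp add: Bf_def Alice_simps Alice_comm)

lemma Bf_cong: "(\<And>b. b < 5 \<Longrightarrow> f b = g b) \<Longrightarrow> Bf y f v = Bf y g v"
  by (simp add: Bf_def)

text \<open>Stands in for projectivity of Bob's measurement: once \<open>g\<close> is realised on
  Alice's side as a scalar on every \<open>B y b \<psi>\<close>, \<open>Bf y g\<close> composes as
  if the \<open>B y b\<close> were orthogonal projections; see \<open>Bf_multiplier\<close>.\<close>

definition multiplier :: "nat \<Rightarrow> (nat \<Rightarrow> real) \<Rightarrow> bool" where
  "multiplier y g \<longleftrightarrow> (\<exists>R\<in>Alice. \<forall>b<5. R (B y b \<psi>) = g b *\<^sub>R B y b \<psi>)"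

lemma multiplierI:
  assumes "R \<in> Alice" "\<And>b. b < 5 \<Longrightarrow> R (B y b \<psi>) = g b *\<^sub>R B y b \<psi>"
  shows "multiplier y g"
  using assms unfolding multiplier_def by blast

lemma multiplier_cong: "multiplier y g \<Longrightarrow> (\<And>b. b < 5 \<Longrightarrow> f b = g b) \<Longrightarrow> multiplier y f"
  unfolding multiplier_def by simp

lemma multiplier_add: "multiplier y f \<Longrightarrow> multiplier y g \<Longrightarrow> multiplier y (\<lambda>b. f b + g b)"
proof -
  assume "multiplier y f" "multiplier y g"
  then obtain R S where R: "R \<in> Alice" "\<And>b. b < 5 \<Longrightarrow> R (B y b \<psi>) = f b *\<^sub>R B y b \<psi>"
    and S: "S \<in> Alice" "\<And>b. b < 5 \<Longrightarrow> S (B y b \<psi>) = g b *\<^sub>R B y b \<psi>"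
    unfolding multiplier_def by blast
  show ?thesis
    by (rule multiplierI[OF Alice_add[OF R(1) S(1)]]) (simp add: R S scaleR_left_distrib)
qed

lemma multiplier_scale:
  assumes "multiplier y f"
  shows "multiplier y (\<lambda>b. c * f b)"
proof -
  obtain R where R: "R \<in> Alice" "\<And>b. b < 5 \<Longrightarrow> R (B y b \<psi>) = f b *\<^sub>R B y b \<psi>"
    using assms unfolding multiplier_def by blast
  show ?thesis
    by (rule multiplierI[OF Alice_scale[OF R(1), of c]]) (simp add: R)
qed

lemma multiplier_mult: "multiplier y f \<Longrightarrow> multiplier y g \<Longrightarrow> multiplier y (\<lambda>b. f b * g b)"
proof -
  assume "multiplier y f" "multiplier y g"
  then obtain R S where R: "R \<in> Alice" "\<And>b. b < 5 \<Longrightarrow> R (B y b \<psi>) = f b *\<^sub>R B y b \<psi>"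
    and S: "S \<in> Alice" "\<And>b. b < 5 \<Longrightarrow> S (B y b \<psi>) = g b *\<^sub>R B y b \<psi>"
    unfolding multiplier_def by blast
  show ?thesis
    by (rule multiplierI[OF Alice_comp[OF R(1) S(1)]]) (simp add: R S Alice_simps[OF R(1)] mult.commute)
qed

text \<open>Losing answers contribute 0 whatever their coefficient, so every coefficient may be
  replaced by \<open>r\<close>, and Alice's row sums to the identity.\<close>

lemma row_multiplier:
  assumes x: "x < 4" and y: "y < 3" and b: "b < 5"
    and c: "\<And>a. a < 5 \<Longrightarrow> (\<Sum>i<5. uc x a i * wc y b i) \<noteq> 0 \<Longrightarrow> c a = r"
  shows "(\<Sum>a<5. c a *\<^sub>R A x a (B y b \<psi>)) = r *\<^sub>R B y b \<psi>"
proof -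
  have "(\<Sum>a<5. c a *\<^sub>R A x a (B y b \<psi>)) = (\<Sum>a<5. r *\<^sub>R A x a (B y b \<psi>))"
  proof (rule sum.cong[OF refl])
    fix a :: nat assume "a \<in> {..<5}"
    then show "c a *\<^sub>R A x a (B y b \<psi>) = r *\<^sub>R A x a (B y b \<psi>)"
      using c[of a] lose[OF x y _ b, of a] by (cases "(\<Sum>i<5. uc x a i * wc y b i) = 0") auto
  qed
  then show ?thesis
    using sumA[OF x, of "B y b \<psi>"] by (simp add: scaleR_sum_right[symmetric])
qed

lemma multiplier_row:
  assumes "x < 4" "y < 3"
    and "\<forall>b<5. \<forall>a<5. (\<Sum>i<5. uc x a i * wc y b i) \<noteq> 0 \<longrightarrow> c a = g b"
  shows "multiplier y g"
  unfolding multiplier_def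
proof (rule bexI)
  show "(\<lambda>v. \<Sum>a<5. c a *\<^sub>R A x a v) \<in> Alice"
    by (intro Alice_sum Alice_scale Alice_A)
  show "\<forall>b<5. (\<Sum>a<5. c a *\<^sub>R A x a (B y b \<psi>)) = g b *\<^sub>R B y b \<psi>"
    using assms row_multiplier by blast
qed

text \<open>Alice's rows realise the indicators of 4, 3, 1, {0,1} and {2,3}, and these five span all
  functions of five outcomes.\<close>

lemma multiplier_0: "multiplier 0 g"
proof -
  let ?d = "\<lambda>i b. of_bool (b = i) :: real"
  have 4: "multiplier 0 (?d 4)"
    by (rule multiplier_row[of 0 _ "?d 4"]) (unfold small_simps, simp_all add: uc_def wc_def)
  have 3: "multiplier 0 (?d 3)"
    by (rule multiplier_row[of 2 _ "?d 4"]) (unfold small_simps, simp_all add: uc_def wc_def)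
  have 1: "multiplier 0 (?d 1)"
    by (rule multiplier_row[of 3 _ "?d 4"]) (unfold small_simps, simp_all add: uc_def wc_def)
  have 01: "multiplier 0 (\<lambda>b. of_bool (b < 2))"
    by (rule multiplier_row[of 0 _ "\<lambda>a. of_bool (a < 2)"]) (unfold small_simps, simp_all add: uc_def wc_def)
  have 23: "multiplier 0 (\<lambda>b. of_bool (b = 2 \<or> b = 3))"
    by (rule multiplier_row[of 0 _ "\<lambda>a. of_bool (a = 2 \<or> a = 3)"]) (unfold small_simps, simp_all add: uc_def wc_def)
  have "multiplier 0 (\<lambda>b. g 4 * ?d 4 b + ((g 3 - g 2) * ?d 3 b + ((g 1 - g 0) * ?d 1 b
      + (g 0 * of_bool (b < 2) + g 2 * of_bool (b = 2 \<or> b = 3)))))"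
    by (intro multiplier_add multiplier_scale 4 3 1 01 23)
  then show ?thesis
    by (rule multiplier_cong) (auto dest: less_5_cases)
qed

text \<open>On the outcomes 0, 1, 4 and the common class of 2 and 3, the sign products
  \<open>?f\<close> and \<open>?h\<close> take all four pairs of signs. So 1, \<open>?f\<close>,
  \<open>?h\<close> and \<open>?f * ?h\<close> span the functions that do not separate 2 from
  3.\<close>

lemma multiplier_12:
  assumes y: "y = 1 \<or> y = 2" and g: "g 2 = g 3"
  shows "multiplier y g"
proof -
  let ?f = "\<lambda>b. wc y b 0 * wc y b 1" and ?h = "\<lambda>b. wc y b 0 * wc y b 2"
  have 1: "multiplier y ?f"
  proof (rule multiplier_row[of 0])
    \<comment> \<open>Coefficients by Alice's answer: those on e_0, e_1 determine the sign product
      directly, those on e_2, e_3 through the product of all four signs (-1 in row 1, 1 in row 2),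
      and answer 4 wins only against outcomes 2 and 3.\<close>
    show "\<forall>b<5. \<forall>a<5. (\<Sum>i<5. uc 0 a i * wc y b i) \<noteq> 0 \<longrightarrow>
        (if y = 1 then [-1, 1, 1, -1, -1] else [-1, 1, -1, 1, 1]) ! a = wc y b 0 * wc y b 1"
      using y unfolding small_simps by (elim disjE) (simp_all add: uc_def wc_def)
  qed (use y in auto)
  have 2: "multiplier y ?h"
  proof (rule multiplier_row[of 1])
    show "\<forall>b<5. \<forall>a<5. (\<Sum>i<5. uc 1 a i * wc y b i) \<noteq> 0 \<longrightarrow>
        (if y = 1 then [1, -1, 1, 1, -1] else [-1, -1, 1, -1, 1]) ! a = wc y b 0 * wc y b 2"
      using y unfolding small_simps by (elim disjE) (simp_all add: uc_def wc_def)
  qed (use y in auto)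
  have 0: "multiplier y (\<lambda>b. 1)"
    by (rule multiplier_row[of 0 _ "\<lambda>a. 1"]) (use y in auto)
  \<comment> \<open>Fourier inversion over the four sign pairs, with outcome 2 representing both 2
    and 3.\<close>
  define c0 c1 c2 c3 where "c0 = (g 0 + g 1 + g 2 + g 4) / 4"
    and "c1 = (g 0 * ?f 0 + g 1 * ?f 1 + g 2 * ?f 2 + g 4 * ?f 4) / 4"
    and "c2 = (g 0 * ?h 0 + g 1 * ?h 1 + g 2 * ?h 2 + g 4 * ?h 4) / 4"
    and "c3 = (g 0 * (?f 0 * ?h 0) + g 1 * (?f 1 * ?h 1) + g 2 * (?f 2 * ?h 2) + g 4 * (?f 4 * ?h 4)) / 4"
  have "multiplier y (\<lambda>b. c0 * 1 + (c1 * ?f b + (c2 * ?h b + c3 * (?f b * ?h b))))"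
    by (intro multiplier_add multiplier_scale multiplier_mult 0 1 2)
  then show ?thesis
  proof (rule multiplier_cong)
    have "\<forall>b<5. g b = c0 * 1 + (c1 * ?f b + (c2 * ?h b + c3 * (?f b * ?h b)))"
      unfolding small_simps c0_def c1_def c2_def c3_def using y g
      by (elim disjE) (simp_all add: wc_def field_simps)
    then show "\<And>b. b < 5 \<Longrightarrow> g b = c0 * 1 + (c1 * ?f b + (c2 * ?h b + c3 * (?f b * ?h b)))"
      by blast
  qed
qed

text \<open>If \<open>R\<close> realises \<open>g\<close>, then
  \<open>Bf y g \<psi> = R \<psi>\<close>; pulling \<open>R\<close> out through Bob's operators
  multiplies the coefficients outcome by outcome.\<close>

lemma Bf_multiplier:
  assumes y: "y < 3" and g: "multiplier y g" and w: "w \<in> W"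
  shows "Bf y g w \<in> W" and "Bf y f (Bf y g w) = Bf y (\<lambda>b. f b * g b) w"
proof -
  obtain R where R: "R \<in> Alice" and Rb: "\<forall>b<5. R (B y b \<psi>) = g b *\<^sub>R B y b \<psi>"
    using g by (auto simp: multiplier_def)
  obtain X where X: "X \<in> Alice" and wX: "w = X \<psi>"
    using w by (rule W_E)
  have "R \<psi> = R (\<Sum>b<5. B y b \<psi>)"
    by (simp add: sumB y)
  also have "\<dots> = Bf y g \<psi>"
    using Rb by (simp add: Bf_def Alice_simps R)
  finally have g\<psi>: "Bf y g \<psi> = R \<psi>" by simp
  show "Bf y g w \<in> W"
    using R X by (simp add: wX Bf_comm g\<psi> W_I W_Alice)
  have "Bf y f (R \<psi>) = Bf y (\<lambda>b. f b * g b) \<psi>"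
    unfolding Bf_comm[OF R] using Rb by (simp add: Bf_def Alice_simps R)
  then show "Bf y f (Bf y g w) = Bf y (\<lambda>b. f b * g b) w"
    by (simp add: wX Bf_comm X g\<psi>)
qed

end

section \<open>Signs and the magic square\<close>

lemma block_sums:
  assumes "(x,a,i,j) \<in> blocks"
  shows "(\<Sum>k<5. uc x a k * f k) = f i - f j" and "(\<Sum>k<5. uc x (Suc a) k * f k) = f i + f j"
proof -
  have 1: "(\<Sum>k<5. of_bool (k = m) * f k) = f m" if "m < 5" for m
    using that by (auto simp: sum_of_bool_mult_eq)
  note ij = block_range(4,5)[OF assms]
  have "(\<Sum>k<5. uc x a k * f k) = (\<Sum>k<5. of_bool (k = i) * f k - of_bool (k = j) * f k)"
    using block_rows(1)[OF assms] by (intro sum.cong) (auto simp: left_diff_distrib)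
  then show "(\<Sum>k<5. uc x a k * f k) = f i - f j"
    using ij by (simp add: sum_subtractf 1)
  have "(\<Sum>k<5. uc x (Suc a) k * f k) = (\<Sum>k<5. of_bool (k = i) * f k + of_bool (k = j) * f k)"
    using block_rows(2)[OF assms] by (intro sum.cong) (auto simp: distrib_right)
  then show "(\<Sum>k<5. uc x (Suc a) k * f k) = f i + f j"
    using ij by (simp add: sum.distrib 1)
qed

lemma block_support:
  assumes "(x,a,i,j) \<in> blocks"
  shows "\<forall>k<5. \<forall>a'<5. uc x a' k \<noteq> 0 \<longrightarrow> (a' = a \<or> a' = Suc a \<longleftrightarrow> k = i \<or> k = j)"
proof -
  have "\<forall>(x,a,i,j) \<in> blocks. \<forall>k<5. \<forall>a'<5. uc x a' k \<noteq> 0 \<longrightarrow> (a' = a \<or> a' = Suc a \<longleftrightarrow> k = i \<or> k = j)"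
    unfolding blocks_def ball_simps prod.case all_less_5 by (simp add: uc_def)
  then show ?thesis
    using assms by fast
qed

lemma sum_wc_0:
  assumes "k < 5"
  shows "(\<Sum>i<5. f i * wc 0 k i) = f k * wc 0 k k"
proof -
  have "(\<Sum>i<5. f i * wc 0 k i) = (\<Sum>i\<in>{k}. f i * wc 0 k i)"
    by (rule sum.mono_neutral_right) (use assms wc_0 in auto)
  then show ?thesis by simp
qed

lemma wc_12:
  assumes "y = 1 \<or> y = 2" "i < 4" "b < 5"
  shows "wc y b i = 1 \<or> wc y b i = -1" "wc y b i * wc y b i = 1" "wc y b i * (wc y b i * r) = r"
proof -
  have "\<forall>i<4. \<forall>b<5. wc y b i = 1 \<or> wc y b i = -1"
    using assms(1) unfolding small_simps by (elim disjE) (simp_all add: wc_def)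
  then show *: "wc y b i = 1 \<or> wc y b i = -1"
    using assms by blast
  then show "wc y b i * wc y b i = 1" "wc y b i * (wc y b i * r) = r"
    by auto
qed

lemma wc_2_3:
  assumes "y = 1 \<or> y = 2" "i < 4"
  shows "wc y 2 i = wc y 3 i"
proof -
  have "\<forall>i<4. wc y 2 i = wc y 3 i"
    using assms(1) unfolding small_simps by (elim disjE) (simp_all add: wc_def)
  then show ?thesis
    using assms by blast
qed

text \<open>The parity clash behind the magic square argument.\<close>

lemma wc_prod_4:
  assumes "b < 5"
  shows "(\<Prod>i<4. wc 1 b i) = -1" and "(\<Prod>i<4. wc 2 b i) = 1"
proof -
  have "\<forall>b<5. wc 1 b 0 * wc 1 b 1 * wc 1 b 2 * wc 1 b 3 = -1 \<and> wc 2 b 0 * wc 2 b 1 * wc 2 b 2 * wc 2 b 3 = 1"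
    unfolding small_simps by (simp add: wc_def)
  then show "(\<Prod>i<4. wc 1 b i) = -1" and "(\<Prod>i<4. wc 2 b i) = 1"
    using assms by (simp_all add: numeral_eq_Suc)
qed

text \<open>Multiply the product of the four signs by two of them: each squares to 1.\<close>

lemma wc_complementary_pairs:
  assumes ijkl: "{i,j,k,l} = {..<4::nat}" and b: "b < 5"
  shows "wc 1 b j * wc 1 b k = - (wc 1 b i * wc 1 b l)" and "wc 2 b j * wc 2 b k = wc 2 b i * wc 2 b l"
proof -
  have lt: "i < 4" "j < 4" "k < 4" "l < 4"
    using ijkl by auto
  have "card {i,j,k,l} = 4"
    using ijkl by simp
  then have "distinct [i,j,k,l]"
    by (intro card_distinct) simp
  then have prod: "(\<Prod>m<4. f m) = f i * f j * f k * f l" for f :: "nat \<Rightarrow> real"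
    unfolding ijkl[symmetric] by (simp add: mult.assoc)
  show "wc 1 b j * wc 1 b k = - (wc 1 b i * wc 1 b l)"
    using wc_prod_4(1)[OF b] wc_12(1)[of 1 i b] wc_12(1)[of 1 l b] lt b unfolding prod by auto
  show "wc 2 b j * wc 2 b k = wc 2 b i * wc 2 b l"
    using wc_prod_4(2)[OF b] wc_12(1)[of 2 i b] wc_12(1)[of 2 l b] lt b unfolding prod by auto
qed

lemma sum_scaleR_pair:
  fixes f :: "nat \<Rightarrow> 'a::real_vector"
  assumes "i < n" "j < n" "i \<noteq> j"
  shows "(\<Sum>k<n. of_bool (k = i \<or> k = j) *\<^sub>R f k) = f i + f j"
proof -
  have "(\<Sum>k<n. of_bool (k = i \<or> k = j) *\<^sub>R f k) = (\<Sum>k\<in>{i,j}. of_bool (k = i \<or> k = j) *\<^sub>R f k)"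
    by (rule sum.mono_neutral_right) (use assms in auto)
  then show ?thesis
    using assms by simp
qed

lemma ex_block:
  assumes "i < 4" "j < 4" "i \<noteq> j"
  obtains x a where "(x,a,i,j) \<in> blocks \<or> (x,a,j,i) \<in> blocks"
proof -
  have lt: "\<exists>x a. (x,a,i,j) \<in> blocks" if "i < j" "j < 4" for i j
  proof -
    have "(0,0,0,1) \<in> blocks" "(0,2,2,3) \<in> blocks" "(1,1,0,2) \<in> blocks" "(1,3,1,3) \<in> blocks"
      "(2,0,1,2) \<in> blocks" "(3,0,0,3) \<in> blocks"
      by (simp_all add: blocks_def)
    moreover have "i = 0 \<and> j = 1 \<or> i = 2 \<and> j = 3 \<or> i = 0 \<and> j = 2 \<or> i = 1 \<and> j = 3
        \<or> i = 1 \<and> j = 2 \<or> i = 0 \<and> j = 3"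
      using that by linarith
    ultimately show ?thesis by blast
  qed
  show thesis
    using lt[of i j] lt[of j i] assms that by (meson linorder_neqE_nat)
qed

context perfect_game
begin

section \<open>Bob's projections from question 0 and Alice's copies of them\<close>

abbreviation \<beta> :: "nat \<Rightarrow> 'v \<Rightarrow> 'v" where
  "\<beta> \<equiv> B 0"

lemma Bf_single: "i < 5 \<Longrightarrow> Bf y (\<lambda>b. r * of_bool (b = i)) v = r *\<^sub>R B y i v"
  by (auto dest!: less_5_cases simp: Bf_def sum_less_5)

lemma \<beta>_eq_Bf: "i < 5 \<Longrightarrow> \<beta> i v = Bf 0 (\<lambda>b. of_bool (b = i)) v"
  using Bf_single[of i 0 1 v] by simp

lemma \<beta>_W: "i < 5 \<Longrightarrow> w \<in> W \<Longrightarrow> \<beta> i w \<in> W"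
  using Bf_multiplier(1)[of 0, OF _ multiplier_0] by (simp add: \<beta>_eq_Bf)

lemma \<beta>_mult:
  assumes "i < 5" "k < 5" "w \<in> W"
  shows "\<beta> i (\<beta> k w) = (if i = k then \<beta> k w else 0)"
proof -
  have "\<beta> i (\<beta> k w) = Bf 0 (\<lambda>b. of_bool (b = i) * of_bool (b = k)) w"
    using assms Bf_multiplier(2)[of 0, OF _ multiplier_0] by (simp add: \<beta>_eq_Bf)
  also have "\<dots> = Bf 0 (\<lambda>b. of_bool (i = k) * of_bool (b = k)) w"
    by (rule Bf_cong) auto
  finally show ?thesis
    by (simp add: Bf_single assms)
qed

text \<open>Turns a function of Alice's answer into a function of Bob's: expand \<psi> by question
  \<open>y\<close> and apply \<open>row_multiplier\<close> to each outcome.\<close>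

lemma row_sum:
  assumes "x < 4" "y < 3"
    and "\<And>a b. a < 5 \<Longrightarrow> b < 5 \<Longrightarrow> (\<Sum>i<5. uc x a i * wc y b i) \<noteq> 0 \<Longrightarrow> c a = g b"
  shows "(\<Sum>a<5. c a *\<^sub>R A x a \<psi>) = Bf y g \<psi>"
proof -
  have "(\<Sum>a<5. c a *\<^sub>R A x a \<psi>) = (\<Sum>a<5. c a *\<^sub>R A x a (\<Sum>b<5. B y b \<psi>))"
    by (simp add: sumB assms)
  also have "\<dots> = (\<Sum>b<5. \<Sum>a<5. c a *\<^sub>R A x a (B y b \<psi>))"
    by (simp add: A_simps scaleR_sum_right) (rule sum.swap)
  also have "\<dots> = Bf y g \<psi>"
    unfolding Bf_def using assms by (intro sum.cong refl row_multiplier) auto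
  finally show ?thesis .
qed

text \<open>Against question 0, outcome \<open>b\<close> wins with answer \<open>a'\<close> exactly
  when \<open>uc x a' b\<close> is nonzero, so the indicators of \<open>a\<close> and
  \<open>k\<close> correspond under \<open>row_sum\<close>.\<close>

lemma single_answer:
  assumes "x < 4" "a < 5" "k < 5"
    and "\<forall>a'<5. \<forall>b<5. uc x a' b \<noteq> 0 \<longrightarrow> (a' = a \<longleftrightarrow> b = k)"
  shows "A x a \<psi> = \<beta> k \<psi>"
proof -
  have "(\<Sum>a'<5. of_bool (a' = a) *\<^sub>R A x a' \<psi>) = Bf 0 (\<lambda>b. of_bool (b = k)) \<psi>"
    using assms by (intro row_sum) (auto simp: sum_wc_0)
  moreover have "(\<Sum>a'<5. of_bool (a' = a) *\<^sub>R A x a' \<psi>) = (\<Sum>a'\<in>{a}. of_bool (a' = a) *\<^sub>R A x a' \<psi>)"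
    by (rule sum.mono_neutral_right) (use assms in auto)
  ultimately show ?thesis
    using \<open>k < 5\<close> by (simp add: \<beta>_eq_Bf)
qed

lemma single_answers:
  "A 0 4 \<psi> = \<beta> 4 \<psi>" "A 1 0 \<psi> = \<beta> 4 \<psi>" "A 2 4 \<psi> = \<beta> 3 \<psi>" "A 3 4 \<psi> = \<beta> 1 \<psi>"
  by (rule single_answer; (unfold small_simps)?; simp add: uc_def)+

lemma block_sum:
  assumes "(x,a,i,j) \<in> blocks"
  shows "A x a \<psi> + A x (Suc a) \<psi> = \<beta> i \<psi> + \<beta> j \<psi>"
proof -
  note r = block_range[OF assms]
  have "(\<Sum>a'<5. of_bool (a' = a \<or> a' = Suc a) *\<^sub>R A x a' \<psi>)
      = Bf 0 (\<lambda>b. of_bool (b = i \<or> b = j)) \<psi>"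
    using r block_support[OF assms] by (intro row_sum) (auto simp: sum_wc_0)
  moreover have "(\<Sum>a'<5. of_bool (a' = a \<or> a' = Suc a) *\<^sub>R A x a' \<psi>) = A x a \<psi> + A x (Suc a) \<psi>"
    using r(3) by (subst sum_scaleR_pair) auto
  moreover have "Bf 0 (\<lambda>b. of_bool (b = i \<or> b = j)) \<psi> = \<beta> i \<psi> + \<beta> j \<psi>"
    unfolding Bf_def using r(4-6) by (intro sum_scaleR_pair)
  ultimately show ?thesis
    by simp
qed

text \<open>Alice's copies of the projections \<beta>. Rows 0, 2 and 3 isolate e_4, e_3 and e_1; e_0
  and e_2 arise by subtraction from a block of row 0.\<close>

definition P :: "nat \<Rightarrow> 'v \<Rightarrow> 'v" where
  "P i v = (if i = 0 then A 0 0 v + A 0 1 v - A 3 4 v else if i = 1 then A 3 4 v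
    else if i = 2 then A 0 2 v + A 0 3 v - A 2 4 v else if i = 3 then A 2 4 v else A 0 4 v)"

lemma P_Alice: "P i \<in> Alice"
proof -
  have "P i = (if i = 0 then (\<lambda>v. A 0 0 v + A 0 1 v - A 3 4 v) else if i = 1 then A 3 4
    else if i = 2 then (\<lambda>v. A 0 2 v + A 0 3 v - A 2 4 v) else if i = 3 then A 2 4 else A 0 4)"
    by (auto simp: P_def)
  then show ?thesis
    by (simp add: Alice_A Alice_add Alice_diff)
qed

lemma P_sum: "(\<Sum>i<5. P i v) = v"
  using sumA[of 0 v] by (simp add: P_def sum_less_5 add.assoc)

lemma P_self: "inner (P i v) w = inner v (P i w)"
  by (simp add: P_def selfA inner_add_left inner_add_right inner_diff_left inner_diff_right)

lemma P_psi: "i < 5 \<Longrightarrow> P i \<psi> = \<beta> i \<psi>"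
proof -
  have "A 0 0 \<psi> + A 0 1 \<psi> = \<beta> 0 \<psi> + \<beta> 1 \<psi>" "A 0 2 \<psi> + A 0 3 \<psi> = \<beta> 2 \<psi> + \<beta> 3 \<psi>"
    using block_sum[of 0 0 0 1] block_sum[of 0 2 2 3] by (simp_all add: blocks_def)
  then show "P i \<psi> = \<beta> i \<psi>" if "i < 5"
    using less_5_cases[OF that] by (auto simp: P_def single_answers)
qed

lemma P_\<beta>: "i < 5 \<Longrightarrow> k < 5 \<Longrightarrow> P i (\<beta> k \<psi>) = (if i = k then \<beta> k \<psi> else 0)"
  using \<beta>_mult[OF _ _ W_psi, of k i] by (auto simp: Alice_comm[OF P_Alice, symmetric] P_psi)

section \<open>Alice's block observables and Bob's sign observables\<close>

definition Obs :: "nat \<Rightarrow> nat \<Rightarrow> 'v \<Rightarrow> 'v" where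
  "Obs x a v = A x (Suc a) v - A x a v"

lemma Obs_Alice: "Obs x a \<in> Alice"
  using Alice_diff[OF Alice_A Alice_A, of x "Suc a" x a] by (simp add: Obs_def[abs_def])

text \<open>When coordinates \<open>i\<close> and \<open>j\<close> of \<open>wc y b\<close> are
  equal or opposite, one of e_i - e_j and e_i + e_j is orthogonal to it. That answer loses, and the
  other carries the whole block sum.\<close>

lemma Obs_B:
  assumes "(x,a,i,j) \<in> blocks" "y < 3" "b < 5" "wc y b i = s * wc y b j" "s = 1 \<or> s = -1"
  shows "Obs x a (B y b \<psi>) = s *\<^sub>R B y b (\<beta> i \<psi> + \<beta> j \<psi>)"
proof -
  note r = block_range[OF assms(1)]
  have sum: "A x a (B y b \<psi>) + A x (Suc a) (B y b \<psi>) = B y b (\<beta> i \<psi> + \<beta> j \<psi>)"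
    by (simp add: comm B_simps(1)[symmetric] block_sum[OF assms(1)])
  from assms(5) show ?thesis
  proof
    assume "s = 1"
    then have "A x a (B y b \<psi>) = 0"
      using assms r by (intro lose) (simp_all add: block_sums[OF assms(1)])
    then show ?thesis
      using sum \<open>s = 1\<close> by (simp add: Obs_def)
  next
    assume "s = -1"
    then have "A x (Suc a) (B y b \<psi>) = 0"
      using assms r by (intro lose) (simp_all add: block_sums[OF assms(1)])
    then show ?thesis
      using sum \<open>s = -1\<close> by (simp add: Obs_def)
  qed
qed

lemma Obs_other_\<beta>:
  assumes "(x,a,i,j) \<in> blocks" "k < 5" "k \<noteq> i" "k \<noteq> j"
  shows "Obs x a (\<beta> k \<psi>) = 0"
proof -
  note r = block_range[OF assms(1)]
  have "uc x a k = 0" "uc x (Suc a) k = 0"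
    using block_support[OF assms(1)] r assms by blast+
  then show ?thesis
    using lose[of x 0 a k] lose[of x 0 "Suc a" k] r assms by (simp add: Obs_def sum_wc_0)
qed

text \<open>Expand \<psi> by question 0: for \<open>k\<close> outside the block both answers lose on
  \<open>\<beta> k \<psi>\<close>.\<close>

lemma Obs_psi:
  assumes "(x,a,i,j) \<in> blocks"
  shows "Obs x a \<psi> = \<beta> i (Obs x a \<psi>) + \<beta> j (Obs x a \<psi>)"
proof -
  note r = block_range[OF assms(1)]
  have "Obs x a \<psi> = Obs x a (\<Sum>k<5. \<beta> k \<psi>)"
    by (simp add: sumB)
  also have "\<dots> = (\<Sum>k<5. Obs x a (\<beta> k \<psi>))"
    by (simp add: Alice_simps[OF Obs_Alice])
  also have "\<dots> = (\<Sum>k\<in>{i,j}. Obs x a (\<beta> k \<psi>))"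
    by (rule sum.mono_neutral_right) (use r Obs_other_\<beta>[OF assms] in auto)
  finally have "Obs x a \<psi> = Obs x a (\<beta> i \<psi>) + Obs x a (\<beta> j \<psi>)"
    using r by simp
  then show ?thesis
    unfolding Alice_comm[OF Obs_Alice] .
qed

definition T :: "nat \<Rightarrow> nat \<Rightarrow> nat \<Rightarrow> 'v \<Rightarrow> 'v" where
  "T y i j = Bf y (\<lambda>b. wc y b i * wc y b j)"

lemma T_simps: "T y i j (v + w) = T y i j v + T y i j w" "T y i j (v - w) = T y i j v - T y i j w"
    "T y i j (c *\<^sub>R v) = c *\<^sub>R T y i j v" "T y i j 0 = 0" "T y i j (- v) = - T y i j v"
  by (simp_all add: T_def Bf_simps)

lemma T_Alice_comm: "X \<in> Alice \<Longrightarrow> T y i j (X v) = X (T y i j v)"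
  by (simp add: T_def Bf_comm)

lemma T_sym: "T y i j = T y j i"
  by (simp add: T_def mult.commute)

lemma T_W:
  assumes "y = 1 \<or> y = 2" "i < 4" "j < 4" "w \<in> W"
  shows "T y i j w \<in> W"
  unfolding T_def using assms
  by (intro Bf_multiplier(1) multiplier_12) (auto simp: wc_2_3)

lemma T_diag:
  assumes "y = 1 \<or> y = 2" "i < 4"
  shows "T y i i v = v"
proof -
  have "T y i i v = Bf y (\<lambda>b. 1) v"
    unfolding T_def by (rule Bf_cong) (use assms wc_12 in simp)
  then show ?thesis
    using assms sumB[of y v] by (auto simp: Bf_def)
qed

text \<open>The sign at \<open>j\<close> occurs twice and squares to 1.\<close>

lemma T_T:
  assumes "y = 1 \<or> y = 2" "i < 4" "j < 4" "k < 4" "w \<in> W"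
  shows "T y i j (T y j k w) = T y i k w"
proof -
  have "T y i j (T y j k w) = Bf y (\<lambda>b. wc y b i * wc y b j * (wc y b j * wc y b k)) w"
    unfolding T_def using assms
    by (intro Bf_multiplier(2) multiplier_12) (auto simp: wc_2_3)
  also have "\<dots> = T y i k w"
    unfolding T_def by (rule Bf_cong) (use assms wc_12(3)[of y j] in \<open>simp add: mult.assoc\<close>)
  finally show ?thesis .
qed

lemma T_complementary:
  assumes "{i,j,k,l} = {..<4::nat}"
  shows "T 1 j k v = - T 1 i l v" "T 2 j k v = T 2 i l v"
  using wc_complementary_pairs[OF assms]
  by (simp_all add: T_def Bf_def sum_negf[symmetric] scaleR_minus_left[symmetric] del: scaleR_minus_left)

text \<open>\<open>Obs_B\<close> applies to every outcome with \<open>s\<close> the product of the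
  two signs. The left side is free of \<open>y\<close>, which is what ties Bob's questions 1 and 2
  together.\<close>

lemma block_T:
  assumes "(x,a,i,j) \<in> blocks" "j < 4" "y = 1 \<or> y = 2"
  shows "Obs x a \<psi> = T y i j (\<beta> i \<psi> + \<beta> j \<psi>)"
proof -
  note r = block_range[OF assms(1)]
  have "Obs x a (B y b \<psi>) = (wc y b i * wc y b j) *\<^sub>R B y b (\<beta> i \<psi> + \<beta> j \<psi>)" if "b < 5" for b
  proof (rule Obs_B[OF assms(1)])
    show "wc y b i = wc y b i * wc y b j * wc y b j"
      using wc_12(2)[OF assms(3,2) that] by (simp add: mult.assoc)
    show "wc y b i * wc y b j = 1 \<or> wc y b i * wc y b j = -1"
      using wc_12(1)[OF assms(3) r(7) that] wc_12(1)[OF assms(3,2) that] by (elim disjE) simp_all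
  qed (use assms(3) that in auto)
  then have "(\<Sum>b<5. Obs x a (B y b \<psi>)) = T y i j (\<beta> i \<psi> + \<beta> j \<psi>)"
    by (simp add: T_def Bf_def)
  moreover have "(\<Sum>b<5. Obs x a (B y b \<psi>)) = Obs x a (\<Sum>b<5. B y b \<psi>)"
    by (simp add: Alice_simps[OF Obs_Alice])
  ultimately show ?thesis
    using assms(3) sumB[of y \<psi>] by auto
qed

text \<open>On \<open>\<beta> i \<psi> + \<beta> j \<psi>\<close> both facts come from
  \<open>block_T\<close> for the two questions and \<open>Obs_psi\<close>; the commutant carries
  them to \<open>W\<close>.\<close>

lemma T_\<beta>:
  assumes "i < 4" "j < 4" "i \<noteq> j" "w \<in> W"
  shows "T 2 i j (\<beta> i w) = T 1 i j (\<beta> i w)"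
    and "T 1 i j (\<beta> i w) = \<beta> i (T 1 i j (\<beta> i w)) + \<beta> j (T 1 i j (\<beta> i w))"
proof -
  obtain x a where xa: "Obs x a \<psi> = T 1 i j (\<beta> i \<psi> + \<beta> j \<psi>)" "Obs x a \<psi> = T 2 i j (\<beta> i \<psi> + \<beta> j \<psi>)"
    "Obs x a \<psi> = \<beta> i (Obs x a \<psi>) + \<beta> j (Obs x a \<psi>)"
  proof -
    obtain x a where "(x,a,i,j) \<in> blocks \<or> (x,a,j,i) \<in> blocks"
      using ex_block assms by metis
    then show thesis
    proof
      assume b: "(x,a,i,j) \<in> blocks"
      show thesis
        using block_T[OF b assms(2)] Obs_psi[OF b] by (intro that) auto
    next
      assume b: "(x,a,j,i) \<in> blocks"
      show thesis
        using block_T[OF b assms(1)] Obs_psi[OF b] by (intro that) (auto simp: T_sym[of _ i j] add.commute)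
    qed
  qed
  have lift: "T 2 i j (\<beta> i v + \<beta> j v) = T 1 i j (\<beta> i v + \<beta> j v)"
      "T 1 i j (\<beta> i v + \<beta> j v) = \<beta> i (T 1 i j (\<beta> i v + \<beta> j v)) + \<beta> j (T 1 i j (\<beta> i v + \<beta> j v))"
    if v: "v \<in> W" for v
  proof -
    obtain X where X: "X \<in> Alice" "v = X \<psi>"
      using v by (rule W_E)
    have *: "T 2 i j (\<beta> i \<psi> + \<beta> j \<psi>) = T 1 i j (\<beta> i \<psi> + \<beta> j \<psi>)"
      using xa(1,2) by simp
    then have "X (T 2 i j (\<beta> i \<psi> + \<beta> j \<psi>)) = X (T 1 i j (\<beta> i \<psi> + \<beta> j \<psi>))"
      by simp
    then show "T 2 i j (\<beta> i v + \<beta> j v) = T 1 i j (\<beta> i v + \<beta> j v)"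
      by (simp add: X Alice_comm T_Alice_comm Alice_simps T_simps)
    define z where "z = T 1 i j (\<beta> i \<psi> + \<beta> j \<psi>)"
    have Tv: "T 1 i j (\<beta> i v + \<beta> j v) = X z"
      by (simp add: z_def X Alice_comm T_Alice_comm Alice_simps T_simps)
    have "\<beta> i (X z) + \<beta> j (X z) = X (\<beta> i z + \<beta> j z)"
      by (simp add: X Alice_comm Alice_simps)
    also have "\<beta> i z + \<beta> j z = z"
      using xa(3) unfolding xa(1) z_def by simp
    finally show "T 1 i j (\<beta> i v + \<beta> j v) = \<beta> i (T 1 i j (\<beta> i v + \<beta> j v)) + \<beta> j (T 1 i j (\<beta> i v + \<beta> j v))"
      unfolding Tv by simp
  qed
  \<comment> \<open>Taking \<open>v = \<beta> i w\<close> removes the second summand, since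
    \<open>\<beta> j (\<beta> i w) = 0\<close>.\<close>
  show "T 2 i j (\<beta> i w) = T 1 i j (\<beta> i w)"
    "T 1 i j (\<beta> i w) = \<beta> i (T 1 i j (\<beta> i w)) + \<beta> j (T 1 i j (\<beta> i w))"
    using lift[OF \<beta>_W[of i w]] assms by (simp_all add: \<beta>_mult)
qed

text \<open>Write t for \<open>T 1 i j (\<beta> i w)\<close> and let k be the fourth index. Evaluate
  T_ik t for both questions: complementary pairs carry a minus sign in question 1 and none in
  question 2, while the two questions agree on each range. Adding the results leaves twice T_ik
  (\<beta>_i t) equal to 0.\<close>

lemma magic_square:
  assumes "i < 4" "j < 4" "l < 4" "distinct [i,j,l]" "w \<in> W"
  shows "\<beta> i (T 1 i j (\<beta> i w)) = 0"
proof -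
  obtain k where k: "{i,j,k,l} = {..<4}"
  proof -
    have "card ({..<4} - {i,j,l}) = 1"
      using assms by (subst card_Diff_subset) auto
    then obtain k where "{..<4} - {i,j,l} = {k}"
      by (auto simp: card_1_singleton_iff)
    then have "{i,j,k,l} = {..<4}"
      using assms by auto
    then show thesis ..
  qed
  then have k4: "k < 4" by auto
  have "card {i,j,k,l} = 4"
    using k by simp
  then have ne: "i \<noteq> k" "j \<noteq> k" "k \<noteq> l"
    using assms(4) by (auto simp: card_insert_if split: if_splits)
  have jikl: "{j,i,k,l} = {..<4}"
    using k by blast
  let ?t = "T 1 i j (\<beta> i w)"
  have W1: "\<beta> i w \<in> W" "?t \<in> W"
    using assms by (auto intro!: \<beta>_W T_W)
  have t: "?t = \<beta> i ?t + \<beta> j ?t" and t2: "T 2 i j (\<beta> i w) = ?t"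
    using T_\<beta>[of i j w] assms by auto
  have T2: "T 2 m n (\<beta> m ?t) = T 1 m n (\<beta> m ?t)" if "m < 4" "n < 4" "m \<noteq> n" for m n
    using T_\<beta>(1)[OF that W1(2)] .
  have "T 1 k i ?t = T 1 k j (\<beta> i w)"
    using T_T[of 1 k i j] k4 assms W1 by simp
  then have "T 1 i k ?t = - T 1 i l (\<beta> i w)"
    using T_complementary(1)[OF k, of "\<beta> i w"] by (simp add: T_sym)
  moreover have "T 1 i k ?t = T 1 i k (\<beta> i ?t) - T 1 j l (\<beta> j ?t)"
    using arg_cong[OF t, of "T 1 i k"] T_complementary(1)[OF jikl, of "\<beta> j ?t"] by (simp only: T_simps) simp
  ultimately have e1: "T 1 i k (\<beta> i ?t) - T 1 j l (\<beta> j ?t) = - T 1 i l (\<beta> i w)"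
    by simp
  have "T 2 k i (T 2 i j (\<beta> i w)) = T 2 k j (\<beta> i w)"
    using T_T[of 2 k i j] k4 assms W1 by simp
  then have "T 2 i k ?t = T 2 i l (\<beta> i w)"
    using T_complementary(2)[OF k, of "\<beta> i w"] by (simp add: T_sym t2)
  moreover have "T 2 i k ?t = T 2 i k (\<beta> i ?t) + T 2 j l (\<beta> j ?t)"
    using arg_cong[OF t, of "T 2 i k"] T_complementary(2)[OF jikl, of "\<beta> j ?t"] by (simp only: T_simps)
  ultimately have e2: "T 1 i k (\<beta> i ?t) + T 1 j l (\<beta> j ?t) = T 1 i l (\<beta> i w)"
    using T2[of i k] T2[of j l] T_\<beta>(1)[of i l w] assms ne k4 by simp
  have "T 1 i k (\<beta> i ?t) + T 1 i k (\<beta> i ?t) = 0"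
    using arg_cong2[OF e1 e2, of "(+)"] by simp
  then have *: "T 1 i k (\<beta> i ?t) = 0"
    by (simp add: scaleR_2[symmetric])
  \<comment> \<open>\<open>T 1 i k\<close> is an involution on \<open>W\<close>, hence injective
    there.\<close>
  have "\<beta> i ?t = T 1 k i (T 1 i k (\<beta> i ?t))"
    using T_T[of 1 k i k "\<beta> i ?t"] T_T[of 1 i k i "\<beta> i ?t"] T_diag[of 1 i] W1 k4 assms
    by (simp add: \<beta>_W T_sym[of _ k i])
  then show "\<beta> i ?t = 0"
    unfolding * by (simp add: T_simps)
qed

end

section \<open>Matrix units\<close>

\<comment> \<open>keeps the row index of \<open>T 1 i j\<close> from being rewritten to \<open>Suc 0\<close>\<close>
declare One_nat_def [simp del]

text \<open>The sign vectors of outcomes 0, 1, 4 and of the common class of 2 and 3 form a 4 by 4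
  Hadamard matrix.\<close>

lemma wc_orthogonal:
  assumes "y = 1 \<or> y = 2" "b < 5" "b' < 5"
  shows "(\<Sum>i<4. wc y b i * wc y b' i) = (if b = b' \<or> {b, b'} = {2, 3} then 4 else 0)"
proof -
  have "\<forall>b<5. \<forall>b'<5. (\<Sum>i<4. wc y b i * wc y b' i)
      = (if b = b' \<or> b = 2 \<and> b' = 3 \<or> b = 3 \<and> b' = 2 then 4 else 0)"
    using assms(1) unfolding small_simps by (elim disjE) (simp_all add: wc_def)
  then show ?thesis
    using assms by (simp add: doubleton_eq_iff)
qed

lemma neg_eq_self_iff: "- v = v \<longleftrightarrow> v = 0" for v :: "'a::real_vector"
proof
  assume "- v = v"
  then have "2 *\<^sub>R v = 0"
    by (metis ab_left_minus scaleR_2)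
  then show "v = 0" by simp
qed simp

context perfect_game
begin

text \<open>By \<open>T_\<beta>\<close> only components at \<open>i\<close> and \<open>j\<close> can
  occur, and \<open>magic_square\<close> removes the one at \<open>i\<close>.\<close>

lemma T_move:
  assumes "i < 4" "j < 4" "w \<in> W"
  shows "\<beta> j (T 1 j i (\<beta> i w)) = T 1 j i (\<beta> i w)"
proof (cases "i = j")
  case True
  then show ?thesis
    using assms by (simp add: T_diag \<beta>_mult)
next
  case False
  have "\<exists>l<4. l \<noteq> i \<and> l \<noteq> j"
    using assms by (intro exI[of _ "if i \<noteq> 0 \<and> j \<noteq> 0 then 0 else if i \<noteq> 1 \<and> j \<noteq> 1 then 1 else 2"]) auto
  then obtain l where "l < 4" "distinct [i,j,l]"
    using False by auto
  then have "\<beta> i (T 1 i j (\<beta> i w)) = 0"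
    using magic_square assms by blast
  then show ?thesis
    using T_\<beta>(2)[OF assms(1,2) False assms(3)] by (simp add: T_sym)
qed

lemma T_rows:
  assumes "y = 1 \<or> y = 2" "i < 4" "j < 4" "w \<in> W"
  shows "T y i j (\<beta> j w) = T 1 i j (\<beta> j w)"
  using assms T_\<beta>(1)[of j i w] T_diag[of 1 j] T_diag[of 2 j]
  by (cases "i = j") (auto simp: T_sym)

section \<open>Sum and difference of Bob's outcomes 2 and 3\<close>

definition G :: "nat \<Rightarrow> 'v \<Rightarrow> 'v" where
  "G y v = B y 2 v + B y 3 v"

text \<open>The sign \<open>wc y 2 0\<close> makes \<open>H 1\<close> and \<open>H 2\<close> agree on the range of \<open>\<beta> 0\<close>.\<close>

definition H :: "nat \<Rightarrow> 'v \<Rightarrow> 'v" where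
  "H y v = wc y 2 0 *\<^sub>R (B y 2 v - B y 3 v)"

lemma G_simps: "G y (v + w) = G y v + G y w" "G y (v - w) = G y v - G y w"
    "G y (c *\<^sub>R v) = c *\<^sub>R G y v" "G y 0 = 0" "G y (- v) = - G y v"
  by (simp_all add: G_def B_simps algebra_simps)

lemma H_simps: "H y (v + w) = H y v + H y w" "H y (v - w) = H y v - H y w"
    "H y (c *\<^sub>R v) = c *\<^sub>R H y v" "H y 0 = 0" "H y (- v) = - H y v"
  by (simp_all add: H_def B_simps algebra_simps)

lemma G_Alice_comm: "X \<in> Alice \<Longrightarrow> G y (X v) = X (G y v)"
  by (simp add: G_def Alice_comm Alice_simps)

lemma H_Alice_comm: "X \<in> Alice \<Longrightarrow> H y (X v) = X (H y v)"
  by (simp add: H_def Alice_comm Alice_simps)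

lemmas Bob_comm = Alice_comm T_Alice_comm G_Alice_comm H_Alice_comm

lemmas Bob_simps = B_simps(1-5) T_simps G_simps H_simps

lemma G_eq_Bf: "G y v = Bf y (\<lambda>b. of_bool (b = 2 \<or> b = 3)) v"
  by (simp add: G_def Bf_def sum_less_5)

lemma H_eq_Bf: "H y v = Bf y (\<lambda>b. wc y 2 0 * (of_bool (b = 2) - of_bool (b = 3))) v"
  by (simp add: H_def Bf_def sum_less_5 algebra_simps)

text \<open>\<open>G\<close> is the inner factor because its coefficients agree on 2 and 3, as
  \<open>multiplier_12\<close> requires.\<close>

lemma H_G:
  assumes "y = 1 \<or> y = 2" "w \<in> W"
  shows "H y (G y w) = H y w"
proof -
  have "H y (G y w) = Bf y (\<lambda>b. wc y 2 0 * (of_bool (b = 2) - of_bool (b = 3)) * of_bool (b = 2 \<or> b = 3)) w"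
    unfolding H_eq_Bf G_eq_Bf using assms by (intro Bf_multiplier(2) multiplier_12) auto
  also have "\<dots> = H y w"
    unfolding H_eq_Bf by (rule Bf_cong) auto
  finally show ?thesis .
qed

text \<open>Inverts the definition of \<open>T\<close> by Hadamard orthogonality. Outcomes 2 and 3
  share their first four signs, so only their sum \<open>G\<close> is recovered.\<close>

lemma B_\<beta>:
  assumes y: "y = 1 \<or> y = 2" and b: "b < 5" and j: "j < 4" and w: "w \<in> W"
  shows "(if b = 2 \<or> b = 3 then G y (\<beta> j w) else B y b (\<beta> j w))
    = (\<Sum>i<4. (wc y b i * wc y b j / 4) *\<^sub>R T 1 i j (\<beta> j w))"
proof -
  let ?v = "\<beta> j w"
  have "(\<Sum>i<4. (wc y b i * wc y b j / 4) *\<^sub>R T 1 i j ?v) = (\<Sum>i<4. (wc y b i * wc y b j / 4) *\<^sub>R T y i j ?v)"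
    using T_rows[OF y _ j w] by simp
  also have "\<dots> = (\<Sum>i<4. \<Sum>b'<5. (wc y b i * wc y b j / 4 * (wc y b' i * wc y b' j)) *\<^sub>R B y b' ?v)"
    by (simp add: T_def Bf_def scaleR_sum_right)
  also have "\<dots> = (\<Sum>b'<5. \<Sum>i<4. (wc y b i * wc y b j / 4 * (wc y b' i * wc y b' j)) *\<^sub>R B y b' ?v)"
    by (rule sum.swap)
  also have "\<dots> = (\<Sum>b'<5. ((\<Sum>i<4. wc y b i * wc y b' i) * (wc y b j * wc y b' j / 4)) *\<^sub>R B y b' ?v)"
    by (simp add: scaleR_sum_left[symmetric] sum_distrib_left sum_distrib_right mult_ac)
  also have "\<dots> = (\<Sum>b'<5. of_bool (b = b' \<or> {b, b'} = {2, 3}) *\<^sub>R B y b' ?v)"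
  proof (rule sum.cong[OF refl])
    fix b' :: nat assume "b' \<in> {..<5}"
    then show "((\<Sum>i<4. wc y b i * wc y b' i) * (wc y b j * wc y b' j / 4)) *\<^sub>R B y b' ?v
      = of_bool (b = b' \<or> {b, b'} = {2, 3}) *\<^sub>R B y b' ?v"
      using wc_orthogonal[OF y b, of b'] wc_12(2)[OF y j b] wc_2_3[OF y j] wc_12(2)[OF y j, of 3]
      by (auto simp: doubleton_eq_iff)
  qed
  also have "\<dots> = (if b = 2 \<or> b = 3 then G y ?v else B y b ?v)"
    using less_5_cases[OF b] by (auto simp: G_def sum_less_5 doubleton_eq_iff)
  finally show ?thesis ..
qed

text \<open>These vectors have no e_4 component, so they lose against Alice's answer e_4 in row 0,
  whose operator agrees with \<open>\<beta> 4\<close> on \<psi>.\<close>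

lemma B_\<beta>_4:
  assumes y: "y = 1 \<or> y = 2" and b: "b = 0 \<or> b = 1 \<or> b = 4" and w: "w \<in> W"
  shows "B y b (\<beta> 4 w) = 0"
proof -
  obtain X where X: "X \<in> Alice" "w = X \<psi>"
    using w by (rule W_E)
  have "(\<Sum>i<5. uc 0 4 i * wc y b i) = 0"
    using y b unfolding sum_less_5 by (elim disjE) (simp_all add: uc_def wc_def)
  then have "A 0 4 (B y b \<psi>) = 0"
    using y b by (intro lose) auto
  then have "B y b (\<beta> 4 \<psi>) = 0"
    by (simp add: comm single_answers)
  then have "X (B y b (\<beta> 4 \<psi>)) = 0"
    by (simp add: Alice_simps X)
  then show ?thesis
    by (simp add: X Bob_comm)
qed

lemma G_\<beta>_4: "y = 1 \<or> y = 2 \<Longrightarrow> w \<in> W \<Longrightarrow> G y (\<beta> 4 w) = \<beta> 4 w"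
  using B_\<beta>_4[of y] sumB[of y "\<beta> 4 w"] by (auto simp: G_def sum_less_5)

lemma G_\<beta>:
  assumes "y = 1 \<or> y = 2" "j < 4" "w \<in> W"
  shows "G y (\<beta> j w) = (\<Sum>i<4. (wc y 2 i * wc y 2 j / 4) *\<^sub>R T 1 i j (\<beta> j w))"
  using B_\<beta>[of y 2 j w] assms by simp

lemma \<beta>_T:
  assumes "k < 5" "i < 4" "j < 4" "w \<in> W"
  shows "\<beta> k (T 1 i j (\<beta> j w)) = (if k = i then T 1 i j (\<beta> j w) else 0)"
proof -
  have "T 1 i j (\<beta> j w) \<in> W"
    using assms by (simp add: T_W \<beta>_W)
  then show ?thesis
    using T_move[of j i w] \<beta>_mult[of k i "T 1 i j (\<beta> j w)"] assms by simp
qed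

lemma \<beta>_G_\<beta>:
  assumes "y = 1 \<or> y = 2" "i < 4" "j < 4" "w \<in> W"
  shows "\<beta> i (G y (\<beta> j w)) = (wc y 2 i * wc y 2 j / 4) *\<^sub>R T 1 i j (\<beta> j w)"
proof -
  have "\<beta> i (G y (\<beta> j w)) = (\<Sum>k<4. (wc y 2 k * wc y 2 j / 4) *\<^sub>R \<beta> i (T 1 k j (\<beta> j w)))"
    using assms by (simp add: G_\<beta> B_simps)
  also have "\<dots> = (\<Sum>k\<in>{i}. (wc y 2 k * wc y 2 j / 4) *\<^sub>R \<beta> i (T 1 k j (\<beta> j w)))"
    by (rule sum.mono_neutral_right) (use assms in \<open>auto simp: \<beta>_T\<close>)
  finally show ?thesis
    using assms by (simp add: \<beta>_T)
qed

lemma \<beta>_4_G: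
  assumes "y = 1 \<or> y = 2" "w \<in> W"
  shows "\<beta> 4 (G y w) = \<beta> 4 w"
proof -
  have "\<beta> 4 (G y (\<beta> j w)) = 0" if "j < 4" for j
    using assms that by (simp add: G_\<beta> B_simps \<beta>_T)
  then have "\<beta> 4 (G y (\<Sum>j<5. \<beta> j w)) = \<beta> 4 w"
    using assms by (simp add: sum_less_5 G_simps B_simps G_\<beta>_4 \<beta>_mult)
  then show ?thesis
    by (simp add: sumB)
qed

text \<open>On the ranges of \<beta>_0 to \<beta>_3, \<open>G y\<close> acts as the projection onto
  the sign vector of outcome 2, so it sees T_ij only through the product of the signs at i and j;
  \<open>H_G\<close> passes this on to \<open>H\<close>.\<close>

lemma H_T:
  assumes y: "y = 1 \<or> y = 2" and i: "i < 4" and j: "j < 4" and w: "w \<in> W"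
  shows "H y (T 1 i j (\<beta> j w)) = (wc y 2 i * wc y 2 j) *\<^sub>R H y (\<beta> j w)"
proof -
  let ?u = "T 1 i j (\<beta> j w)"
  have W: "\<beta> j w \<in> W" "?u \<in> W"
    using assms by (simp_all add: T_W \<beta>_W)
  have "G y ?u = G y (\<beta> i ?u)"
    using T_move[OF j i w] by simp
  also have "\<dots> = (\<Sum>k<4. (wc y 2 k * wc y 2 i / 4) *\<^sub>R T 1 k i ?u)"
    using T_move[OF j i w] G_\<beta>[OF y i W(2)] by simp
  also have "\<dots> = (\<Sum>k<4. (wc y 2 i * wc y 2 j) *\<^sub>R ((wc y 2 k * wc y 2 j / 4) *\<^sub>R T 1 k j (\<beta> j w)))"
    using wc_12(2)[OF y j, of 2] T_T[of 1 _ i j, OF _ _ i j W(1)] by (auto intro!: sum.cong simp: mult_ac)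
  also have "\<dots> = (wc y 2 i * wc y 2 j) *\<^sub>R G y (\<beta> j w)"
    using G_\<beta>[OF y j w] by (simp add: scaleR_sum_right)
  finally have "H y (G y ?u) = (wc y 2 i * wc y 2 j) *\<^sub>R H y (G y (\<beta> j w))"
    by (simp add: H_simps)
  then show ?thesis
    using W by (simp add: H_G[OF y])
qed

text \<open>\<open>G y\<close> preserves the \<beta>_4 component, and its compression to the range
  of \<beta>_i is 1/4.\<close>

lemma G_inj:
  assumes "y = 1 \<or> y = 2" "i < 4" "v \<in> W" "v = \<beta> i v + \<beta> 4 v" "G y v = 0"
  shows "v = 0"
proof -
  have 4: "\<beta> 4 v = 0"
    using \<beta>_4_G[OF assms(1,3)] assms(5) by (simp add: B_simps)
  then have v: "\<beta> i v = v"
    using assms(4) by simp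
  have "(1/4) *\<^sub>R v = \<beta> i (G y (\<beta> i v))"
    using \<beta>_G_\<beta>[OF assms(1,2,2,3)] wc_12(2)[OF assms(1,2), of 2] T_diag[of 1 i v] v assms(2) by simp
  then show ?thesis
    using assms(5) v by (simp add: B_simps)
qed

section \<open>The corner blocks, which join the index 4 to 0 and 2\<close>

lemma Obs_W: "Obs x a \<psi> \<in> W"
  by (rule W_I[OF Obs_Alice])

text \<open>Outcomes 2 and 3 differ only in the sign at 4, so the observable acts on them with
  opposite signs and exchanges their sum with their difference.\<close>

lemma G_H_Obs:
  assumes blk: "(x,a,i,4) \<in> blocks" and y: "y = 1 \<or> y = 2"
  shows "G y (Obs x a \<psi>) = (wc y 2 0 * wc y 2 i) *\<^sub>R H y (\<beta> i \<psi> + \<beta> 4 \<psi>)"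
    and "H y (Obs x a \<psi>) = (wc y 2 0 * wc y 2 i) *\<^sub>R G y (\<beta> i \<psi> + \<beta> 4 \<psi>)"
proof -
  let ?z = "\<beta> i \<psi> + \<beta> 4 \<psi>"
  have i: "i < 4" using block_range[OF blk] by simp
  have w4: "wc y 2 4 = 1" "wc y 3 4 = -1"
    using y by (auto simp: wc_def)
  have y3: "y < 3" using y by auto
  have *: "wc y 2 i = 1 \<or> wc y 2 i = -1" "wc y 2 0 * wc y 2 0 = 1"
    using wc_12(1)[OF y i, of 2] wc_12(2)[OF y, of 0 2] by auto
  have "Obs x a (B y 2 \<psi>) = wc y 2 i *\<^sub>R B y 2 ?z"
    by (rule Obs_B[OF blk y3]) (use w4 * in auto)
  moreover have "Obs x a (B y 3 \<psi>) = (- wc y 2 i) *\<^sub>R B y 3 ?z"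
    by (rule Obs_B[OF blk y3]) (use w4 * wc_2_3[OF y i] in auto)
  ultimately have B: "B y 2 (Obs x a \<psi>) = wc y 2 i *\<^sub>R B y 2 ?z" "B y 3 (Obs x a \<psi>) = (- wc y 2 i) *\<^sub>R B y 3 ?z"
    by (simp_all only: Alice_comm[OF Obs_Alice])
  show "G y (Obs x a \<psi>) = (wc y 2 0 * wc y 2 i) *\<^sub>R H y ?z"
    using *(2) by (simp add: G_def H_def B scaleR_diff_right mult_ac)
      (simp add: mult.assoc[symmetric])
  show "H y (Obs x a \<psi>) = (wc y 2 0 * wc y 2 i) *\<^sub>R G y ?z"
    by (simp add: G_def H_def B algebra_simps)
qed

lemma P_\<beta>_sum:
  assumes "i < 4" "k < 5"
  shows "P k (\<beta> i \<psi> + \<beta> 4 \<psi>) = (if k = i \<or> k = 4 then \<beta> k \<psi> else 0)"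
  using assms by (auto simp: Alice_simps[OF P_Alice] P_\<beta>)

lemma G_H_P_Obs:
  assumes blk: "(x,a,i,4) \<in> blocks" and y: "y = 1 \<or> y = 2" and k: "k < 5"
  shows "G y (P k (Obs x a \<psi>)) = (wc y 2 0 * wc y 2 i) *\<^sub>R H y (if k = i \<or> k = 4 then \<beta> k \<psi> else 0)"
    and "H y (P k (Obs x a \<psi>)) = (wc y 2 0 * wc y 2 i) *\<^sub>R G y (if k = i \<or> k = 4 then \<beta> k \<psi> else 0)"
proof -
  have i: "i < 4" using block_range[OF blk] by simp
  show "G y (P k (Obs x a \<psi>)) = (wc y 2 0 * wc y 2 i) *\<^sub>R H y (if k = i \<or> k = 4 then \<beta> k \<psi> else 0)"
    unfolding G_Alice_comm[OF P_Alice] G_H_Obs[OF blk y] Alice_simps(3)[OF P_Alice]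
      H_Alice_comm[OF P_Alice, symmetric] P_\<beta>_sum[OF i k] ..
  show "H y (P k (Obs x a \<psi>)) = (wc y 2 0 * wc y 2 i) *\<^sub>R G y (if k = i \<or> k = 4 then \<beta> k \<psi> else 0)"
    unfolding H_Alice_comm[OF P_Alice] G_H_Obs[OF blk y] Alice_simps(3)[OF P_Alice]
      G_Alice_comm[OF P_Alice, symmetric] P_\<beta>_sum[OF i k] ..
qed

lemma W_P_Obs: "P k (Obs x a \<psi>) \<in> W"
  by (rule W_Alice[OF P_Alice Obs_W])

lemma P_Obs_split:
  assumes "(x,a,i,4) \<in> blocks"
  shows "P k (Obs x a \<psi>) = \<beta> i (P k (Obs x a \<psi>)) + \<beta> 4 (P k (Obs x a \<psi>))"
  using arg_cong[OF Obs_psi[OF assms], of "P k"]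
  unfolding Alice_simps(1)[OF P_Alice] Alice_comm[OF P_Alice] .

text \<open>\<open>G 1\<close> sends this vector to a multiple of \<open>H 1 0\<close>, and
  \<open>G_inj\<close> applies to it.\<close>

lemma P_Obs_other:
  assumes "(x,a,i,4) \<in> blocks" "k < 5" "k \<noteq> i" "k \<noteq> 4"
  shows "P k (Obs x a \<psi>) = 0"
proof (rule G_inj[OF disjI1[OF refl] _ W_P_Obs P_Obs_split[OF assms(1)]])
  show "i < 4"
    using block_range[OF assms(1)] by simp
  show "G 1 (P k (Obs x a \<psi>)) = 0"
    using G_H_P_Obs(1)[OF assms(1) disjI1[OF refl] assms(2)] assms by (simp add: H_simps)
qed

lemma Obs_decomp:
  assumes "(x,a,i,4) \<in> blocks"
  shows "Obs x a \<psi> = P i (Obs x a \<psi>) + P 4 (Obs x a \<psi>)"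
proof -
  note r = block_range[OF assms]
  have "Obs x a \<psi> = (\<Sum>k<5. P k (Obs x a \<psi>))"
    by (simp only: P_sum)
  also have "\<dots> = (\<Sum>k\<in>{i,4}. P k (Obs x a \<psi>))"
    by (rule sum.mono_neutral_right) (use r P_Obs_other[OF assms] in auto)
  also have "\<dots> = P i (Obs x a \<psi>) + P 4 (Obs x a \<psi>)"
    using r by simp
  finally show ?thesis .
qed

lemma corner_blocks: "(2,2,0,4) \<in> blocks" "(3,2,2,4) \<in> blocks"
  by (simp_all add: blocks_def)

lemma signs_02: "wc 1 2 0 * wc 1 2 2 = 1" "wc 2 2 0 * wc 2 2 2 = -1"
    "wc 1 2 0 * wc 1 2 0 = 1" "wc 2 2 0 * wc 2 2 0 = 1" "wc 1 2 2 * wc 1 2 0 = 1" "wc 2 2 2 * wc 2 2 0 = -1"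
    "wc 1 2 2 * wc 1 2 2 = 1" "wc 2 2 2 * wc 2 2 2 = 1"
  by (simp_all add: wc_def)

text \<open>By \<open>\<beta>_4_G\<close> both entries are signed copies of
  \<open>\<beta> 4 (H y (\<beta> 4 \<psi>))\<close>. The block at 0 makes the copies for
  \<open>y = 1\<close> and \<open>y = 2\<close> equal and the block at 2 makes them opposite, so
  they vanish.\<close>

lemma corner_44: "\<beta> 4 (P 4 (Obs 2 2 \<psi>)) = 0" "\<beta> 4 (P 4 (Obs 3 2 \<psi>)) = 0"
proof -
  have "\<beta> 4 (P 4 (Obs x a \<psi>)) = (wc y 2 0 * wc y 2 i) *\<^sub>R \<beta> 4 (H y (\<beta> 4 \<psi>))"
    if "(x,a,i,4) \<in> blocks" "y = 1 \<or> y = 2" for x a i y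
    using \<beta>_4_G[OF that(2) W_P_Obs, of 4 x a] G_H_P_Obs(1)[OF that, of 4] by (simp add: B_simps)
  note this[OF corner_blocks(1), of 1] this[OF corner_blocks(1), of 2]
    this[OF corner_blocks(2), of 1] this[OF corner_blocks(2), of 2]
  then have "- \<beta> 4 (H 1 (\<beta> 4 \<psi>)) = \<beta> 4 (H 1 (\<beta> 4 \<psi>))"
    and *: "\<beta> 4 (P 4 (Obs 2 2 \<psi>)) = \<beta> 4 (H 1 (\<beta> 4 \<psi>))"
      "\<beta> 4 (P 4 (Obs 3 2 \<psi>)) = \<beta> 4 (H 1 (\<beta> 4 \<psi>))"
    by (simp_all add: signs_02)
  then have "\<beta> 4 (H 1 (\<beta> 4 \<psi>)) = 0"
    by (simp add: neg_eq_self_iff)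
  then show "\<beta> 4 (P 4 (Obs 2 2 \<psi>)) = 0" "\<beta> 4 (P 4 (Obs 3 2 \<psi>)) = 0"
    by (simp_all add: *)
qed


lemma T_Alice:
  assumes "i < 4" "j < 4"
  obtains X where "X \<in> Alice" "X \<psi> = T 1 i j (\<beta> j \<psi>)"
proof -
  have "T 1 i j (\<beta> j \<psi>) \<in> W"
    using assms by (simp add: T_W \<beta>_W W_psi)
  then show thesis
    using that by (elim W_E) simp
qed

lemma wc_2_square: "y = 1 \<or> y = 2 \<Longrightarrow> i < 4 \<Longrightarrow> wc y 2 i * wc y 2 i = 1"
  using wc_12(2)[of y i 2] by simp

text \<open>The relations of rows 1 and 2 coincide up to the sign \<open>wc y 2 i * wc y 2 j\<close>, which is opposite in
  the two rows. Comparing them leaves no diagonal part.\<close>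

lemma corner_off_diagonal:
  assumes blk: "(x,a,i,4) \<in> blocks" "(x',a',j,4) \<in> blocks"
    and sgn: "wc 1 2 j * wc 1 2 i = 1" "wc 2 2 j * wc 2 2 i = -1"
  shows "\<beta> j (P j (Obs x' a' \<psi>)) = 0"
proof -
  have lt: "i < 4" "j < 4"
    using blk block_range(7) by blast+
  have ij: "i \<noteq> j"
    using sgn(2) wc_2_square[of 2 i] lt by auto
  obtain X where X: "X \<in> Alice" "X \<psi> = T 1 i j (\<beta> j \<psi>)"
    using T_Alice[OF lt] .
  define q q' where "q = P i (Obs x a \<psi>)" and "q' = P j (Obs x' a' \<psi>)"
  have W: "q \<in> W" "q' \<in> W" "X q \<in> W"
    unfolding q_def q'_def by (intro W_P_Obs W_Alice[OF X(1)])+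
  have q: "q = \<beta> i q + \<beta> 4 q" and q': "q' = \<beta> j q' + \<beta> 4 q'"
    unfolding q_def q'_def by (rule P_Obs_split[OF blk(1)] P_Obs_split[OF blk(2)])+
  \<comment> \<open>\<open>X\<close> moves column i to column j, and by \<open>H_T\<close> the
    resulting signs combine to those of \<open>q'\<close>.\<close>
  have Gq: "G y (X q) = G y q'" if y: "y = 1 \<or> y = 2" for y
  proof -
    have "G y (X q) = (wc y 2 0 * wc y 2 i) *\<^sub>R X (H y (\<beta> i \<psi>))"
      using G_H_P_Obs(1)[OF blk(1) y, of i] lt by (simp add: q_def G_Alice_comm X(1) Alice_simps)
    also have "X (H y (\<beta> i \<psi>)) = H y (\<beta> i (T 1 i j (\<beta> j \<psi>)))"
      by (simp add: Bob_comm[OF X(1), symmetric] X(2))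
    also have "\<dots> = (wc y 2 i * wc y 2 j) *\<^sub>R H y (\<beta> j \<psi>)"
      using T_move[OF lt(2,1) W_psi] H_T[OF y lt W_psi] by simp
    also have "(wc y 2 0 * wc y 2 i) *\<^sub>R (wc y 2 i * wc y 2 j) *\<^sub>R H y (\<beta> j \<psi>)
        = (wc y 2 0 * (wc y 2 i * wc y 2 i) * wc y 2 j) *\<^sub>R H y (\<beta> j \<psi>)"
      by (simp add: mult_ac)
    also have "\<dots> = G y q'"
      using G_H_P_Obs(1)[OF blk(2) y, of j] lt by (simp add: q'_def wc_2_square y)
    finally show ?thesis .
  qed
  define z where "z = X q - q'"
  have zW: "z \<in> W"
    using W by (simp add: z_def W_diff)
  have Gz: "G y z = 0" if "y = 1 \<or> y = 2" for y
    using Gq that by (simp add: z_def G_simps)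
  have "X q = \<beta> i (X q) + \<beta> 4 (X q)"
    using arg_cong[OF q, of X] unfolding Alice_simps(1)[OF X(1)] Alice_comm[OF X(1), symmetric] .
  then have "\<beta> j (X q) = \<beta> j (\<beta> i (X q) + \<beta> 4 (X q))"
    by simp
  also have "\<dots> = 0"
    using lt ij W by (simp add: B_simps \<beta>_mult)
  finally have jX: "\<beta> j (X q) = 0" .
  have "\<beta> i q' = \<beta> i (\<beta> j q' + \<beta> 4 q')"
    using q' by simp
  also have "\<dots> = 0"
    using lt ij W by (simp add: B_simps \<beta>_mult)
  finally have iq': "\<beta> i q' = 0" .
  have "z = \<beta> i z + \<beta> j z + \<beta> 4 z"
    unfolding z_def B_simps(2) jX iq' using \<open>X q = \<beta> i (X q) + \<beta> 4 (X q)\<close> q'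
    by (metis (no_types, lifting) add.assoc add.commute add_diff_add diff_0 diff_0_right uminus_add_conv_diff)
  moreover have "\<beta> 4 z = 0"
    using \<beta>_4_G[of 1, OF _ zW] Gz[of 1] by (simp add: B_simps)
  ultimately have z: "\<beta> i z + \<beta> j z = z"
    by simp
  have e: "(wc y 2 j * wc y 2 i / 4) *\<^sub>R T 1 j i (\<beta> i z) + (1/4) *\<^sub>R \<beta> j z = 0"
    if y: "y = 1 \<or> y = 2" for y
  proof -
    have "\<beta> j (G y (\<beta> i z)) + \<beta> j (G y (\<beta> j z)) = \<beta> j (G y (\<beta> i z + \<beta> j z))"
      by (simp add: B_simps G_simps)
    also have "\<dots> = 0"
      using Gz[OF y] by (simp add: z B_simps)
    finally show ?thesis
      using lt y by (simp add: \<beta>_G_\<beta> zW wc_2_square T_diag)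
  qed
  \<comment> \<open>The terms in \<open>T 1 j i\<close> have coefficients 1/4 and -1/4 and
    cancel.\<close>
  have "(1/2) *\<^sub>R \<beta> j z = 0"
    using arg_cong2[OF e[of 1] e[of 2], of "(+)"] by (simp add: sgn scaleR_left_distrib[symmetric])
  then have "\<beta> j z = 0" by simp
  then show ?thesis
    using jX by (simp add: z_def B_simps q'_def)
qed

text \<open>This vector will be E_4i \<psi>. Without diagonal part it lies in the range of
  \<open>\<beta> 4\<close>, where \<open>G y\<close> is the identity, so \<open>G_H_P_Obs\<close>
  evaluates it.\<close>

lemma corner_q:
  assumes "i = 0 \<and> x = 2 \<or> i = 2 \<and> x = 3" and y: "y = 1 \<or> y = 2"
  shows "\<beta> 4 (P i (Obs x 2 \<psi>)) = P i (Obs x 2 \<psi>)"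
    and "P i (Obs x 2 \<psi>) = (wc y 2 0 * wc y 2 i) *\<^sub>R H y (\<beta> i \<psi>)"
proof -
  have blk: "(x,2,i,4) \<in> blocks"
    using assms(1) corner_blocks by auto
  have "\<beta> i (P i (Obs x 2 \<psi>)) = 0"
    using assms(1) corner_off_diagonal[OF corner_blocks(2) corner_blocks(1)]
      corner_off_diagonal[OF corner_blocks(1) corner_blocks(2)] by (auto simp: signs_02)
  then show 4: "\<beta> 4 (P i (Obs x 2 \<psi>)) = P i (Obs x 2 \<psi>)"
    using P_Obs_split[OF blk, of i] by simp
  have "P i (Obs x 2 \<psi>) = G y (P i (Obs x 2 \<psi>))"
    using G_\<beta>_4[OF y W_P_Obs, of i x 2] 4 by simp
  then show "P i (Obs x 2 \<psi>) = (wc y 2 0 * wc y 2 i) *\<^sub>R H y (\<beta> i \<psi>)"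
    using G_H_P_Obs(1)[OF blk y, of i] assms(1) by auto
qed

text \<open>The vectors that become E_04 \<psi> and E_24 \<psi>. They are recovered from their
  common image under \<open>G 1\<close> by compressing, which costs a factor 1/4; hence the
  4.\<close>

lemma corner_p:
  shows "\<beta> 0 (P 4 (Obs 2 2 \<psi>)) = P 4 (Obs 2 2 \<psi>)"
    and "y = 1 \<or> y = 2 \<Longrightarrow> G y (P 4 (Obs 2 2 \<psi>)) = H y (\<beta> 4 \<psi>)"
    and "P 4 (Obs 2 2 \<psi>) = 4 *\<^sub>R \<beta> 0 (H 1 (\<beta> 4 \<psi>))"
    and "P 4 (Obs 3 2 \<psi>) = T 1 2 0 (P 4 (Obs 2 2 \<psi>))"
proof -
  let ?p = "P 4 (Obs 2 2 \<psi>)" and ?p' = "P 4 (Obs 3 2 \<psi>)"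
  show p: "\<beta> 0 ?p = ?p"
    using P_Obs_split[OF corner_blocks(1), of 4] corner_44 by simp
  have p': "\<beta> 2 ?p' = ?p'"
    using P_Obs_split[OF corner_blocks(2), of 4] corner_44 by simp
  show G: "G y ?p = H y (\<beta> 4 \<psi>)" if "y = 1 \<or> y = 2" for y
    using G_H_P_Obs(1)[OF corner_blocks(1) that, of 4] wc_2_square[OF that, of 0] by simp
  have G': "G 1 ?p' = H 1 (\<beta> 4 \<psi>)"
    using G_H_P_Obs(1)[OF corner_blocks(2), of 1 4] by (simp add: signs_02)
  have "\<beta> 0 (G 1 (\<beta> 0 ?p)) = (1/4) *\<^sub>R ?p"
    by (subst \<beta>_G_\<beta>) (simp_all add: W_P_Obs signs_02 T_diag p)
  then show "?p = 4 *\<^sub>R \<beta> 0 (H 1 (\<beta> 4 \<psi>))"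
    using p G[of 1] by simp
  have "\<beta> 2 (G 1 (\<beta> 0 ?p)) = (1/4) *\<^sub>R T 1 2 0 ?p"
    by (subst \<beta>_G_\<beta>) (simp_all add: W_P_Obs signs_02 p)
  moreover have "\<beta> 2 (G 1 (\<beta> 2 ?p')) = (1/4) *\<^sub>R ?p'"
    by (subst \<beta>_G_\<beta>) (simp_all add: W_P_Obs signs_02 T_diag p')
  ultimately show "?p' = T 1 2 0 ?p"
    using p p' G[of 1] G' by simp
qed

text \<open>\<open>R i \<circ> L j\<close> is the matrix unit \<open>E\<^sub>i\<^sub>j\<close>, factored through the range of \<open>\<beta> 0\<close>. The factor \<open>4\<close> in \<open>L 4\<close>
  is the ratio of the weights of \<open>\<beta> 0\<close> and \<open>\<beta> 4\<close>.\<close>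

definition R :: "nat \<Rightarrow> 'v \<Rightarrow> 'v" where
  "R i v = (if i = 4 then H 1 (\<beta> 0 v) else T 1 i 0 (\<beta> 0 v))"

definition L :: "nat \<Rightarrow> 'v \<Rightarrow> 'v" where
  "L j v = (if j = 4 then 4 *\<^sub>R \<beta> 0 (H 1 (\<beta> 4 v)) else T 1 0 j (\<beta> j v))"

lemma R_simps: "R i (v + w) = R i v + R i w" "R i (v - w) = R i v - R i w"
    "R i (c *\<^sub>R v) = c *\<^sub>R R i v" "R i 0 = 0"
  by (simp_all add: R_def Bob_simps)

lemma L_simps: "L i (v + w) = L i v + L i w" "L i (v - w) = L i v - L i w"
    "L i (c *\<^sub>R v) = c *\<^sub>R L i v" "L i 0 = 0"
  by (simp_all add: L_def Bob_simps algebra_simps)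

lemma R_Alice_comm: "X \<in> Alice \<Longrightarrow> R i (X v) = X (R i v)"
  by (simp add: R_def Bob_comm)

lemma L_Alice_comm: "X \<in> Alice \<Longrightarrow> L i (X v) = X (L i v)"
  by (simp add: L_def Bob_comm Alice_simps)

text \<open>At \<psi> the vector \<open>R 4 \<psi>\<close> is a corner vector of Alice's observable;
  the claims hold there and are transported by the commutant. \<open>L_4\<close> is proved the same
  way.\<close>

lemma R_4:
  assumes w: "w \<in> W"
  shows "R 4 w \<in> W" "\<beta> 4 (R 4 w) = R 4 w" "y = 1 \<or> y = 2 \<Longrightarrow> H y (\<beta> 0 w) = R 4 w"
    and "H 1 (R 4 w) = G 1 (\<beta> 0 w)"
proof -
  obtain X where X: "X \<in> Alice" "w = X \<psi>"
    using w by (rule W_E)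
  have q: "R 4 \<psi> = P 0 (Obs 2 2 \<psi>)"
    using corner_q(2)[of 0 2 1] by (simp add: R_def signs_02)
  show "R 4 w \<in> W"
    unfolding X(2) R_Alice_comm[OF X(1)] q by (rule W_Alice[OF X(1) W_P_Obs])
  have "\<beta> 4 (R 4 \<psi>) = R 4 \<psi>"
    using corner_q(1)[of 0 2 1] by (simp add: q)
  then have "X (\<beta> 4 (R 4 \<psi>)) = X (R 4 \<psi>)"
    by simp
  then show "\<beta> 4 (R 4 w) = R 4 w"
    by (simp add: X R_Alice_comm Bob_comm)
  show "H y (\<beta> 0 w) = R 4 w" if "y = 1 \<or> y = 2"
  proof -
    have "H y (\<beta> 0 \<psi>) = R 4 \<psi>"
      using corner_q(2)[of 0 2, OF _ that] wc_2_square[OF that, of 0] by (simp add: q)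
    then have "X (H y (\<beta> 0 \<psi>)) = X (R 4 \<psi>)"
      by simp
    then show ?thesis
      by (simp add: X R_Alice_comm Bob_comm)
  qed
  have "H 1 (R 4 \<psi>) = G 1 (\<beta> 0 \<psi>)"
    using G_H_P_Obs(2)[OF corner_blocks(1), of 1 0] by (simp add: q signs_02)
  then have "X (H 1 (R 4 \<psi>)) = X (G 1 (\<beta> 0 \<psi>))"
    by simp
  then show "H 1 (R 4 w) = G 1 (\<beta> 0 w)"
    by (simp add: X R_Alice_comm Bob_comm)
qed

lemma L_4:
  assumes w: "w \<in> W"
  shows "L 4 w \<in> W" "\<beta> 0 (L 4 w) = L 4 w" "y = 1 \<or> y = 2 \<Longrightarrow> H y (\<beta> 4 w) = G y (L 4 w)"
    and "H 1 (L 4 w) = \<beta> 4 w"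
proof -
  obtain X where X: "X \<in> Alice" "w = X \<psi>"
    using w by (rule W_E)
  have p: "L 4 \<psi> = P 4 (Obs 2 2 \<psi>)"
    using corner_p(3) by (simp add: L_def)
  show "L 4 w \<in> W"
    unfolding X(2) L_Alice_comm[OF X(1)] p by (rule W_Alice[OF X(1) W_P_Obs])
  have "\<beta> 0 (L 4 \<psi>) = L 4 \<psi>"
    using corner_p(1) by (simp add: p)
  then have "X (\<beta> 0 (L 4 \<psi>)) = X (L 4 \<psi>)"
    by simp
  then show "\<beta> 0 (L 4 w) = L 4 w"
    by (simp add: X L_Alice_comm Bob_comm)
  show "H y (\<beta> 4 w) = G y (L 4 w)" if "y = 1 \<or> y = 2"
  proof -
    have "H y (\<beta> 4 \<psi>) = G y (L 4 \<psi>)"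
      using corner_p(2)[OF that] by (simp add: p)
    then have "X (H y (\<beta> 4 \<psi>)) = X (G y (L 4 \<psi>))"
      by simp
    then show ?thesis
      by (simp add: X L_Alice_comm Bob_comm)
  qed
  have "H 1 (L 4 \<psi>) = \<beta> 4 \<psi>"
    using G_H_P_Obs(2)[OF corner_blocks(1), of 1 4] by (simp add: p signs_02 G_\<beta>_4 W_psi)
  then have "X (H 1 (L 4 \<psi>)) = X (\<beta> 4 \<psi>)"
    by simp
  then show "H 1 (L 4 w) = \<beta> 4 w"
    by (simp add: X L_Alice_comm Bob_comm)
qed

lemma R_props:
  assumes "i < 5" "w \<in> W"
  shows "R i w \<in> W" "k < 5 \<Longrightarrow> \<beta> k (R i w) = (if k = i then R i w else 0)" "R i (\<beta> 0 w) = R i w"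
proof -
  show W: "R i w \<in> W"
    using assms R_4(1) by (cases "i = 4") (auto simp: R_def T_W \<beta>_W)
  have \<beta>: "\<beta> i (R i w) = R i w"
    using assms R_4(2) by (cases "i = 4") (auto simp: R_def \<beta>_T)
  then show "\<beta> k (R i w) = (if k = i then R i w else 0)" if "k < 5"
    using \<beta>_mult[OF that assms(1) W] by simp
  show "R i (\<beta> 0 w) = R i w"
    using assms by (simp add: R_def \<beta>_mult)
qed

lemma L_props:
  assumes "i < 5" "w \<in> W"
  shows "L i w \<in> W" "\<beta> 0 (L i w) = L i w" "k < 5 \<Longrightarrow> L i (\<beta> k w) = (if i = k then L i w else 0)"
proof -
  show "L i w \<in> W"
    using assms L_4(1) by (cases "i = 4") (auto simp: L_def T_W \<beta>_W)
  show "\<beta> 0 (L i w) = L i w"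
    using assms L_4(2) by (cases "i = 4") (auto simp: L_def \<beta>_T)
  show "L i (\<beta> k w) = (if i = k then L i w else 0)" if "k < 5"
    using assms that by (simp add: L_def \<beta>_mult Bob_simps)
qed

lemma RL:
  assumes "i < 4" "j < 4" "w \<in> W"
  shows "R i (L j w) = T 1 i j (\<beta> j w)"
  using assms T_T[of 1 i 0 j "\<beta> j w"] by (simp add: R_def L_def \<beta>_T \<beta>_W)

lemma RL_diag:
  assumes "i < 5" "w \<in> W"
  shows "R i (L i w) = \<beta> i w"
proof (cases "i = 4")
  case True
  then show ?thesis
    using L_4[OF assms(2)] by (simp add: R_def)
next
  case False
  then show ?thesis
    using assms by (simp add: RL T_diag)
qed

text \<open>For \<open>j = 4\<close>, \<open>H 1\<close> applied twice gives \<open>G 1\<close>, and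
  its compression 1/4 cancels the 4 in \<open>L 4\<close>.\<close>

lemma L_R_diag:
  assumes "j < 5" "w \<in> W"
  shows "L j (R j w) = \<beta> 0 w"
proof (cases "j = 4")
  case True
  have "L 4 (R 4 w) = 4 *\<^sub>R \<beta> 0 (G 1 (\<beta> 0 w))"
    using R_4[OF assms(2)] by (simp add: L_def)
  then show ?thesis
    using True assms by (simp add: \<beta>_G_\<beta> signs_02 T_diag)
next
  case False
  then show ?thesis
    using assms T_T[of 1 0 j 0 "\<beta> 0 w"] by (simp add: R_def L_def \<beta>_T T_diag \<beta>_W)
qed

lemma L_R:
  assumes "j < 5" "k < 5" "w \<in> W"
  shows "L j (R k w) = (if j = k then \<beta> 0 w else 0)"
proof (cases "j = k")
  case False
  have "L j (R k w) = L j (\<beta> k (R k w))"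
    using R_props(2)[OF assms(2,3,2)] by simp
  also have "\<dots> = 0"
    using L_props(3)[OF assms(1) R_props(1)[OF assms(2,3)] assms(2)] False by simp
  finally show ?thesis
    using False by simp
qed (use L_R_diag assms in simp)

text \<open>Blocks below 4 are \<open>block_T\<close>; in a corner block the two terms are the
  columns found in \<open>corner_p\<close> and \<open>corner_q\<close>.\<close>

lemma Obs_RL:
  assumes "(x,a,i,j) \<in> blocks"
  shows "Obs x a \<psi> = R i (L j \<psi>) + R j (L i \<psi>)"
proof (cases "j = 4")
  case False
  then have "i < 4" "j < 4"
    using block_range[OF assms] by auto
  then show ?thesis
    using block_T[OF assms, of 1] by (simp add: RL W_psi T_simps T_sym)
next
  case True
  then have "x = 2 \<and> a = 2 \<and> i = 0 \<or> x = 3 \<and> a = 2 \<and> i = 2"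
    using assms by (auto simp: blocks_def)
  then show ?thesis
  proof
    assume *: "x = 2 \<and> a = 2 \<and> i = 0"
    have "R 0 (L 4 \<psi>) = P 4 (Obs 2 2 \<psi>)"
      using corner_p(1,3) by (simp add: R_def T_diag L_def)
    moreover have "R 4 (L 0 \<psi>) = P 0 (Obs 2 2 \<psi>)"
      using corner_q(2)[of 0 2 1] by (simp add: R_def L_def T_diag signs_02 \<beta>_mult W_psi)
    ultimately show ?thesis
      using Obs_decomp[OF corner_blocks(1)] * True by (simp add: add.commute)
  next
    assume *: "x = 3 \<and> a = 2 \<and> i = 2"
    have "R 2 (L 4 \<psi>) = P 4 (Obs 3 2 \<psi>)"
      using corner_p(1,3,4) by (simp add: R_def L_def)
    moreover have "R 4 (L 2 \<psi>) = P 2 (Obs 3 2 \<psi>)"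
      using corner_q(2)[of 2 3 1] H_T[of 1 0 2 \<psi>] by (simp add: R_def L_def signs_02 \<beta>_T W_psi)
    ultimately show ?thesis
      using Obs_decomp[OF corner_blocks(2)] * True by (simp add: add.commute)
  qed
qed

end

section \<open>Expansion of the measurement operators\<close>

lemma dd_pos: "dd i > 0"
  by (simp add: dd_def)

text \<open>The squared length of Bob's unnormalised vector, since \<open>wc\<close> holds D times
  it.\<close>

definition wnorm :: "nat \<Rightarrow> nat \<Rightarrow> real" where
  "wnorm y b = (\<Sum>k<5. wc y b k * wc y b k / dd k)"

lemma wnorm_0: "b < 5 \<Longrightarrow> wc 0 b b * wc 0 b b / (dd b * wnorm 0 b) = 1"
proof -
  have "\<forall>b<5. wc 0 b b * wc 0 b b / (dd b * wnorm 0 b) = 1"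
    unfolding wnorm_def small_simps by (simp add: wc_def dd_def)
  then show "b < 5 \<Longrightarrow> wc 0 b b * wc 0 b b / (dd b * wnorm 0 b) = 1" by blast
qed

lemma wnorm_12:
  assumes "y = 1 \<or> y = 2" "b < 5"
  shows "wnorm y b = (if b = 2 \<or> b = 3 then 2 else 1)"
    and "wc y b 4 = (if b = 2 then 1 else if b = 3 then -1 else 0)"
proof -
  have "\<forall>b<5. wnorm y b = (if b = 2 \<or> b = 3 then 2 else 1) \<and> wc y b 4 = (if b = 2 then 1 else if b = 3 then -1 else 0)"
    using assms(1) unfolding wnorm_def small_simps by (elim disjE) (simp_all add: wc_def dd_def)
  then show "wnorm y b = (if b = 2 \<or> b = 3 then 2 else 1)"
    "wc y b 4 = (if b = 2 then 1 else if b = 3 then -1 else 0)"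
    using assms(2) by blast+
qed

lemma sum_5_4: "(\<Sum>i<5. f i) = (\<Sum>i<4. f i) + f (4::nat)" for f :: "nat \<Rightarrow> 'a::comm_monoid_add"
  by (simp add: sum_less_5 sum_less_4)

lemma block_cases:
  fixes x a :: nat
  assumes "x < 4" "a < 5"
  obtains (single) k where "(x,a,k) \<in> {(0,4,4),(1,0,4),(2,4,3),(3,4,1::nat)}"
  | (minus) i j where "(x,a,i,j) \<in> blocks"
  | (plus) a' i j where "a = Suc a'" "(x,a',i,j) \<in> blocks"
proof -
  have mem: "(0,0,0,1) \<in> blocks" "(0,2,2,3) \<in> blocks" "(1,1,0,2) \<in> blocks" "(1,3,1,3) \<in> blocks"
      "(2,0,1,2) \<in> blocks" "(2,2,0,4) \<in> blocks" "(3,0,0,3) \<in> blocks" "(3,2,2,4) \<in> blocks"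
    by (simp_all add: blocks_def)
  define single_pos where "single_pos \<longleftrightarrow> x = 0 \<and> a = 4 \<or> x = 1 \<and> a = 0 \<or> x = 2 \<and> a = 4 \<or> x = 3 \<and> a = 4"
  define first where "first a \<longleftrightarrow> x = 0 \<and> a = 0 \<or> x = 0 \<and> a = 2 \<or> x = 1 \<and> a = 1 \<or> x = 1 \<and> a = 3
      \<or> x = 2 \<and> a = 0 \<or> x = 2 \<and> a = 2 \<or> x = 3 \<and> a = 0 \<or> x = 3 \<and> a = 2" for a :: nat
  have ex: "\<exists>i j. (x,a,i,j) \<in> blocks" if "first a" for a
    using that unfolding first_def by (elim disjE) (use mem in blast)+
  have x: "x = 0 \<or> x = 1 \<or> x = 2 \<or> x = 3"
    using assms(1) by linarith
  have "single_pos \<or> first a \<or> (\<exists>a'. a = Suc a' \<and> first a')"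
  proof (cases a)
    case 0
    then have "single_pos \<or> first a"
      using x unfolding single_pos_def first_def by (elim disjE) simp_all
    then show ?thesis by blast
  next
    case (Suc c)
    then have "c = 0 \<or> c = 1 \<or> c = 2 \<or> c = 3"
      using assms by linarith
    then have "single_pos \<or> first a \<or> first c"
      using x unfolding single_pos_def first_def Suc by (elim disjE) simp_all
    then show ?thesis using Suc by blast
  qed
  then consider single_pos | "first a" | a' where "a = Suc a'" "first a'"
    by blast
  then show thesis
  proof cases
    case 1
    then show thesis
      unfolding single_pos_def by (elim disjE) (auto intro: single)
  next
    case 2
    from ex[OF 2] show thesis by (elim exE) (rule minus)
  next
    case 3
    from ex[OF 3(2)] show thesis by (elim exE) (rule plus[OF 3(1)])
  qed
qed

context perfect_game
begin

section \<open>Bob's operators in matrix units\<close>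

lemma H_\<beta>:
  assumes "y = 1 \<or> y = 2" "j < 4" "w \<in> W"
  shows "H y (\<beta> j w) = (wc y 2 0 * wc y 2 j) *\<^sub>R R 4 (L j w)"
proof -
  have "R 4 (L j w) = H y (T 1 0 j (\<beta> j w))"
    using R_4(3)[of "T 1 0 j (\<beta> j w)", OF _ assms(1)] assms R_4(3)[of "L j w", OF _ assms(1)]
    by (simp add: L_def \<beta>_T T_W \<beta>_W)
  also have "\<dots> = (wc y 2 0 * wc y 2 j) *\<^sub>R H y (\<beta> j w)"
    using assms by (simp add: H_T)
  finally have "(wc y 2 0 * wc y 2 j) *\<^sub>R R 4 (L j w)
      = ((wc y 2 0 * wc y 2 0) * (wc y 2 j * wc y 2 j)) *\<^sub>R H y (\<beta> j w)"
    by (simp add: mult_ac)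
  then show ?thesis
    using wc_2_square[OF assms(1)] assms(2) by simp
qed

lemma G_\<beta>_RL:
  assumes "y = 1 \<or> y = 2" "j < 4" "w \<in> W"
  shows "G y (\<beta> j w) = (\<Sum>i<4. (wc y 2 i * wc y 2 j / 4) *\<^sub>R R i (L j w))"
  using assms by (simp add: G_\<beta> RL)

lemma H_\<beta>_4:
  assumes "y = 1 \<or> y = 2" "w \<in> W"
  shows "H y (\<beta> 4 w) = (\<Sum>i<4. (wc y 2 i * wc y 2 0 / 4) *\<^sub>R R i (L 4 w))"
proof -
  have "H y (\<beta> 4 w) = G y (\<beta> 0 (L 4 w))"
    using L_4[OF assms(2)] assms(1) by simp
  also have "\<dots> = (\<Sum>i<4. (wc y 2 i * wc y 2 0 / 4) *\<^sub>R T 1 i 0 (\<beta> 0 (L 4 w)))"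
    using assms L_4(1) by (intro G_\<beta>) auto
  finally show ?thesis
    by (simp add: R_def)
qed

lemma B_2_3:
  assumes "y = 1 \<or> y = 2" "b = 2 \<or> b = 3"
  shows "B y b v = (1/2) *\<^sub>R G y v + (wc y b 4 * wc y 2 0 / 2) *\<^sub>R H y v"
proof -
  have "wc y 2 0 * (wc y 2 0 * r) = r" for r
    using wc_2_square[OF assms(1), of 0] by (simp add: mult.assoc[symmetric])
  then show ?thesis
    using assms(2) wnorm_12(2)[OF assms(1), of b] wc_2_square[OF assms(1), of 0]
    by (auto simp: G_def H_def scaleR_right_distrib scaleR_right_diff_distrib scaleR_left_distrib[symmetric])
qed

text \<open>For Bob's unnormalised vector v, the coefficient of E_ij is (D^-1 v)_i (D v)_j / |v|^2:
  the projection onto v conjugated by D, because E_ij and E_ji are adjoint only up to the ratio of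
  the weights of i and j.\<close>

lemma B_RL_column:
  assumes y: "y < 3" and b: "b < 5" and j: "j < 5" and w: "w \<in> W"
  shows "B y b (\<beta> j w) = (\<Sum>i<5. (wc y b i * wc y b j / dd i / wnorm y b) *\<^sub>R R i (L j w))"
proof (cases "y = 0")
  case True
  have "(\<Sum>i<5. (wc 0 b i * wc 0 b j / dd i / wnorm 0 b) *\<^sub>R R i (L j w))
      = (\<Sum>i\<in>{b}. (wc 0 b i * wc 0 b j / dd i / wnorm 0 b) *\<^sub>R R i (L j w))"
    by (rule sum.mono_neutral_right) (use b wc_0 in auto)
  also have "\<dots> = (if b = j then \<beta> j w else 0)"
    using wc_0 b j w by (auto simp: wnorm_0 RL_diag)
  finally show ?thesis
    using True b j w by (simp add: \<beta>_mult)
next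
  case False
  then have y: "y = 1 \<or> y = 2"
    using y by auto
  have d: "(\<Sum>i<5. (wc y b i * wc y b j / dd i / wnorm y b) *\<^sub>R R i (L j w))
      = (\<Sum>i<4. (wc y b i * wc y b j / 4 / wnorm y b) *\<^sub>R R i (L j w)) + (wc y b 4 * wc y b j / wnorm y b) *\<^sub>R R 4 (L j w)"
    by (simp add: sum_5_4 dd_def)
  show ?thesis
  proof (cases "b = 2 \<or> b = 3")
    case False
    then have b': "b = 0 \<or> b = 1 \<or> b = 4"
      using b by auto
    show ?thesis
    proof (cases "j = 4")
      case True
      then show ?thesis
        using B_\<beta>_4[OF y b' w] wnorm_12(2)[OF y b] False by simp
    next
      case j4: False
      then have "B y b (\<beta> j w) = (\<Sum>i<4. (wc y b i * wc y b j / 4) *\<^sub>R T 1 i j (\<beta> j w))"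
        using B_\<beta>[OF y b _ w, of j] j False by simp
      then show ?thesis
        unfolding d using wnorm_12[OF y b] False j4 j w by (simp add: RL)
    qed
  next
    case b23: True
    have wb: "wc y b i = wc y 2 i" if "i < 4" for i
      using b23 wc_2_3[OF y that] by auto
    have n: "wnorm y b = 2"
      using wnorm_12[OF y b] b23 by simp
    have h0: "wc y 2 0 * (wc y 2 0 * r) = r" for r
      using wc_2_square[OF y, of 0] by (simp add: mult.assoc[symmetric])
    show ?thesis
    proof (cases "j = 4")
      case True
      have "wc y b 4 * wc y b 4 = 1"
        using wnorm_12(2)[OF y b] b23 by auto
      moreover have "(wc y b 4 * wc y 2 0 / 2) *\<^sub>R H y (\<beta> 4 w)
        = (\<Sum>i<4. (wc y b i * wc y b 4 / 4 / 2) *\<^sub>R R i (L 4 w))"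
        unfolding H_\<beta>_4[OF y w] scaleR_sum_right scaleR_scaleR
        using h0 by (intro sum.cong) (auto simp: wb mult_ac)
      ultimately show ?thesis
        unfolding d unfolding n True B_2_3[OF y b23] using w by (simp add: G_\<beta>_4[OF y] RL_diag)
    next
      case False
      then have j4: "j < 4" using j by simp
      have "(1/2) *\<^sub>R G y (\<beta> j w) = (\<Sum>i<4. (wc y b i * wc y b j / 4 / 2) *\<^sub>R R i (L j w))"
        unfolding G_\<beta>_RL[OF y j4 w] scaleR_sum_right scaleR_scaleR
        by (intro sum.cong) (auto simp: wb j4 mult_ac)
      moreover have "(wc y b 4 * wc y 2 0 / 2) *\<^sub>R H y (\<beta> j w) = (wc y b 4 * wc y b j / 2) *\<^sub>R R 4 (L j w)"
        unfolding H_\<beta>[OF y j4 w] scaleR_scaleR using h0 by (simp add: wb j4 mult_ac)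
      ultimately show ?thesis
        unfolding d unfolding n B_2_3[OF y b23] by simp
    qed
  qed
qed

lemma B_RL:
  assumes "y < 3" "b < 5" "w \<in> W"
  shows "B y b w = (\<Sum>j<5. \<Sum>i<5. (wc y b i * wc y b j / dd i / wnorm y b) *\<^sub>R R i (L j w))"
proof -
  have "B y b w = B y b (\<Sum>j<5. \<beta> j w)"
    by (simp add: sumB)
  also have "\<dots> = (\<Sum>j<5. B y b (\<beta> j w))"
    by (rule B_simps(6))
  also have "\<dots> = (\<Sum>j<5. \<Sum>i<5. (wc y b i * wc y b j / dd i / wnorm y b) *\<^sub>R R i (L j w))"
    using assms by (intro sum.cong refl B_RL_column) auto
  finally show ?thesis .
qed

section \<open>Alice's operators on \<psi> in matrix units\<close>

lemma sum_of_bool_scaleR: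
  fixes f :: "nat \<Rightarrow> 'v"
  assumes "i < 5"
  shows "(\<Sum>k<5. of_bool (k = i) *\<^sub>R f k) = f i"
proof -
  have "(\<Sum>k<5. of_bool (k = i) *\<^sub>R f k) = (\<Sum>k\<in>{i}. of_bool (k = i) *\<^sub>R f k)"
    by (rule sum.mono_neutral_right) (use assms in auto)
  then show ?thesis by simp
qed

lemma A_RL_single:
  assumes "k < 5" "\<forall>m<5. uc x a m = of_bool (m = k)" "A x a \<psi> = \<beta> k \<psi>"
  shows "A x a \<psi> = (\<Sum>l<5. \<Sum>m<5. (uc x a m * uc x a l / (\<Sum>n<5. uc x a n * uc x a n)) *\<^sub>R R m (L l \<psi>))"
proof -
  have n: "(\<Sum>n<5. uc x a n * uc x a n) = 1"
    using less_5_cases[OF assms(1)] assms(2) by (auto simp: sum_less_5)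
  have "(\<Sum>l<5. \<Sum>m<5. (uc x a m * uc x a l / 1) *\<^sub>R R m (L l \<psi>))
      = (\<Sum>l<5. of_bool (l = k) *\<^sub>R (\<Sum>m<5. of_bool (m = k) *\<^sub>R R m (L l \<psi>)))"
    using assms(2) by (auto intro!: sum.cong simp: scaleR_sum_right)
  also have "\<dots> = R k (L k \<psi>)"
    by (simp only: sum_of_bool_scaleR[OF assms(1)])
  finally show ?thesis
    unfolding n using assms(1,3) by (simp add: RL_diag W_psi)
qed

text \<open>The projection onto e_i + s e_j is half of E_ii + E_jj + s (E_ij + E_ji).\<close>

lemma A_RL_pair:
  assumes ij: "i < 5" "j < 5" "i \<noteq> j" and s: "s = 1 \<or> s = -1"
    and uc: "\<forall>m<5. uc x a m = of_bool (m = i) + s * of_bool (m = j)"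
    and A: "A x a \<psi> = (1/2) *\<^sub>R (\<beta> i \<psi> + \<beta> j \<psi> + s *\<^sub>R (R i (L j \<psi>) + R j (L i \<psi>)))"
  shows "A x a \<psi> = (\<Sum>l<5. \<Sum>m<5. (uc x a m * uc x a l / (\<Sum>n<5. uc x a n * uc x a n)) *\<^sub>R R m (L l \<psi>))"
proof -
  have supp: "(\<Sum>m<5. f m) = f i + f j" if "\<And>m. uc x a m = 0 \<Longrightarrow> f m = 0" for f :: "nat \<Rightarrow> 'b::comm_monoid_add"
  proof -
    have "(\<Sum>m<5. f m) = (\<Sum>m\<in>{i,j}. f m)"
      by (rule sum.mono_neutral_right) (use ij uc that in auto)
    then show ?thesis using ij by simp
  qed
  have i1: "uc x a i = 1" and js: "uc x a j = s" and ss: "s * s = 1"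
    using uc ij s by auto
  have n: "(\<Sum>n<5. uc x a n * uc x a n) = 2"
    by (subst supp) (simp_all add: i1 js ss)
  have "(\<Sum>l<5. \<Sum>m<5. (uc x a m * uc x a l / 2) *\<^sub>R R m (L l \<psi>))
      = (1/2) *\<^sub>R R i (L i \<psi>) + (s/2) *\<^sub>R R j (L i \<psi>) + ((s/2) *\<^sub>R R i (L j \<psi>) + (1/2) *\<^sub>R R j (L j \<psi>))"
    by (subst supp, simp)+ (simp add: i1 js ss)
  also have "\<dots> = A x a \<psi>"
    using ij unfolding A by (simp add: RL_diag W_psi algebra_simps)
  finally show ?thesis
    unfolding n ..
qed

lemma A_RL:
  assumes "x < 4" "a < 5"
  shows "A x a \<psi> = (\<Sum>l<5. \<Sum>m<5. (uc x a m * uc x a l / (\<Sum>n<5. uc x a n * uc x a n)) *\<^sub>R R m (L l \<psi>))"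
  using assms
proof (cases rule: block_cases)
  case (single k)
  have u: "\<forall>m<5. uc 0 4 m = of_bool (m = 4)" "\<forall>m<5. uc 1 0 m = of_bool (m = 4)"
    "\<forall>m<5. uc 2 4 m = of_bool (m = 3)" "\<forall>m<5. uc 3 4 m = of_bool (m = 1)"
    unfolding all_less_5 by (simp_all add: uc_def)
  from single have "k < 5 \<and> (\<forall>m<5. uc x a m = of_bool (m = k)) \<and> A x a \<psi> = \<beta> k \<psi>"
    using u single_answers by auto
  then show ?thesis
    by (intro A_RL_single) auto
next
  case (minus i j)
  note r = block_range[OF minus]
  show ?thesis
  proof (rule A_RL_pair[OF r(4,5,6), of "-1"])
    show "\<forall>m<5. uc x a m = of_bool (m = i) + - 1 * of_bool (m = j)"
      using block_rows(1)[OF minus] by simp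
    have "A x a \<psi> = (1/2) *\<^sub>R ((A x a \<psi> + A x (Suc a) \<psi>) + (-1) *\<^sub>R (Obs x a \<psi>))"
      by (simp add: Obs_def scaleR_2[symmetric])
    then show "A x a \<psi> = (1/2) *\<^sub>R (\<beta> i \<psi> + \<beta> j \<psi> + - 1 *\<^sub>R (R i (L j \<psi>) + R j (L i \<psi>)))"
      unfolding block_sum[OF minus] Obs_RL[OF minus] .
  qed simp
next
  case (plus a' i j)
  note r = block_range[OF plus(2)]
  show ?thesis
    unfolding plus(1)
  proof (rule A_RL_pair[OF r(4,5,6), of 1])
    show "\<forall>m<5. uc x (Suc a') m = of_bool (m = i) + 1 * of_bool (m = j)"
      using block_rows(2)[OF plus(2)] by simp
    have "A x (Suc a') \<psi> = (1/2) *\<^sub>R ((A x a' \<psi> + A x (Suc a') \<psi>) + 1 *\<^sub>R (Obs x a' \<psi>))"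
      by (simp add: Obs_def scaleR_2[symmetric])
    then show "A x (Suc a') \<psi> = (1/2) *\<^sub>R (\<beta> i \<psi> + \<beta> j \<psi> + 1 *\<^sub>R (R i (L j \<psi>) + R j (L i \<psi>)))"
      unfolding block_sum[OF plus(2)] Obs_RL[OF plus(2)] .
  qed simp
qed

section \<open>Expectations of matrix units and the correlation\<close>

lemma inner_RL_off:
  assumes "i < 5" "j < 5" "i \<noteq> j"
  shows "inner \<psi> (R i (L j \<psi>)) = 0"
proof -
  have W: "L j \<psi> \<in> W"
    using L_props assms W_psi by blast
  have "inner \<psi> (R i (L j \<psi>)) = inner \<psi> (\<beta> i (R i (L j \<psi>)))"
    using R_props(2)[OF assms(1) W] assms by simp
  \<comment> \<open>On \<psi>, \<open>\<beta> i\<close> may be traded for Alice's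
    \<open>P i\<close>, which passes through \<open>R\<close> and \<open>L\<close> and becomes
    \<open>\<beta> i\<close> again, now inside \<open>L j\<close>, which annihilates it.\<close>
  also have "\<dots> = inner (P i \<psi>) (R i (L j \<psi>))"
    using assms by (simp add: selfB[symmetric] P_psi)
  also have "\<dots> = inner \<psi> (R i (L j (P i \<psi>)))"
    unfolding P_self R_Alice_comm[OF P_Alice] L_Alice_comm[OF P_Alice] ..
  also have "\<dots> = 0"
    using assms L_props(3)[OF assms(2) W_psi assms(1)] by (simp add: P_psi R_simps)
  finally show ?thesis .
qed

lemma Obs_self: "x < 4 \<Longrightarrow> Suc a < 5 \<Longrightarrow> inner (Obs x a v) w = inner v (Obs x a w)"
  by (simp add: Obs_def selfA inner_diff_left inner_diff_right)

text \<open>The vector equals \<open>Obs x a (\<beta> j \<psi>)\<close>, and the observable squares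
  to the block projection on \<psi>.\<close>

lemma block_norm:
  assumes blk: "(x,a,i,j) \<in> blocks"
  shows "inner (R j (L i \<psi>)) (R j (L i \<psi>)) = inner \<psi> (\<beta> j \<psi>)"
proof -
  note r = block_range[OF blk]
  have W: "L i \<psi> \<in> W" "L j \<psi> \<in> W" "R i (L j \<psi>) \<in> W" "R j (L i \<psi>) \<in> W"
    using r by (auto intro!: L_props R_props W_psi)
  have j: "R j (L i \<psi>) = Obs x a (\<beta> j \<psi>)"
    using r W by (simp add: Alice_comm[OF Obs_Alice, symmetric] Obs_RL[OF blk] B_simps R_props)
  have "Obs x a (Obs x a \<psi>) = R i (L j (Obs x a \<psi>)) + R j (L i (Obs x a \<psi>))"
    using arg_cong[OF Obs_RL[OF blk], of "Obs x a"]
    unfolding Alice_simps(1)[OF Obs_Alice] R_Alice_comm[OF Obs_Alice, symmetric] L_Alice_comm[OF Obs_Alice, symmetric] .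
  also have "\<dots> = R i (L j (R i (L j \<psi>))) + R i (L j (R j (L i \<psi>))) + (R j (L i (R i (L j \<psi>))) + R j (L i (R j (L i \<psi>))))"
    unfolding Obs_RL[OF blk] L_simps R_simps ..
  also have "\<dots> = \<beta> i \<psi> + \<beta> j \<psi>"
    using r W W_psi by (simp add: L_R R_props R_simps RL_diag)
  finally have sq: "Obs x a (Obs x a \<psi>) = \<beta> i \<psi> + \<beta> j \<psi>" .
  have "inner (R j (L i \<psi>)) (R j (L i \<psi>)) = inner (\<beta> j \<psi>) (Obs x a (Obs x a (\<beta> j \<psi>)))"
    unfolding j using r by (intro Obs_self) auto
  also have "\<dots> = inner (\<beta> j \<psi>) (\<beta> j (\<beta> i \<psi> + \<beta> j \<psi>))"
    by (simp only: Alice_comm[OF Obs_Alice, symmetric] sq)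
  also have "\<dots> = inner \<psi> (\<beta> j \<psi>)"
    using r by (simp add: B_simps \<beta>_mult W_psi selfB)
  finally show ?thesis .
qed

lemma T_self: "y < 3 \<Longrightarrow> inner (T y i j v) w = inner v (T y i j w)"
  by (simp add: T_def Bf_def inner_sum_left inner_sum_right selfB)

text \<open>Evaluates the norm of \<open>block_norm\<close> again on Bob's side:
  \<open>T 1 j 0\<close> is a self-adjoint involution and preserves the weight of \<beta>_0, while
  \<open>H 1\<close> squares to \<open>G 1\<close> there and leaves a quarter of it.\<close>

lemma inner_\<beta>_0:
  assumes "j < 5"
  shows "inner \<psi> (\<beta> j \<psi>) = dd j / 4 * inner \<psi> (\<beta> 0 \<psi>)"
proof (cases "j = 0")
  case True
  then show ?thesis by (simp add: dd_def)
next
  case j0: False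
  obtain x a where blk: "(x,a,0,j) \<in> blocks"
  proof -
    have "(0,0,0,1) \<in> blocks" "(1,1,0,2) \<in> blocks" "(3,0,0,3) \<in> blocks" "(2,2,0,4) \<in> blocks"
      by (simp_all add: blocks_def)
    then show thesis
      using less_5_cases[OF assms] j0 that by (elim disjE) simp_all
  qed
  have "inner \<psi> (\<beta> j \<psi>) = inner (R j (L 0 \<psi>)) (R j (L 0 \<psi>))"
    using block_norm[OF blk] ..
  also have "\<dots> = dd j / 4 * inner \<psi> (\<beta> 0 \<psi>)"
  proof (cases "j = 4")
    case False
    then have "inner (R j (L 0 \<psi>)) (R j (L 0 \<psi>)) = inner (\<beta> 0 \<psi>) (T 1 j 0 (T 1 j 0 (\<beta> 0 \<psi>)))"
      using assms by (simp add: RL W_psi T_self)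
    also have "\<dots> = inner \<psi> (\<beta> 0 \<psi>)"
      using T_T[of 1 0 j 0 "\<beta> 0 \<psi>"] False assms
      by (simp add: T_sym[of _ j 0] T_diag \<beta>_W W_psi selfB \<beta>_mult)
    finally show ?thesis
      using False by (simp add: dd_def)
  next
    case True
    have Hs: "inner (H 1 v) w = inner v (H 1 w)" for v w
      by (simp add: H_def selfB inner_diff_left inner_diff_right)
    have "R 4 (L 0 \<psi>) = R 4 \<psi>"
      using R_props(3)[of 4 \<psi>] by (simp add: L_def T_diag W_psi)
    also have "R 4 \<psi> = H 1 (\<beta> 0 \<psi>)"
      by (simp add: R_def)
    finally have "inner (R 4 (L 0 \<psi>)) (R 4 (L 0 \<psi>)) = inner (\<beta> 0 \<psi>) (H 1 (H 1 (\<beta> 0 \<psi>)))"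
      by (simp add: Hs)
    also have "H 1 (H 1 (\<beta> 0 \<psi>)) = G 1 (\<beta> 0 \<psi>)"
      using R_4(4)[OF W_psi] by (simp add: R_def)
    finally have "inner (R 4 (L 0 \<psi>)) (R 4 (L 0 \<psi>)) = inner (\<beta> 0 \<psi>) (G 1 (\<beta> 0 \<psi>))" .
    also have "\<dots> = inner \<psi> (\<beta> 0 (G 1 (\<beta> 0 \<psi>)))"
      by (simp add: selfB)
    also have "\<dots> = inner \<psi> (\<beta> 0 \<psi>) / 4"
      by (simp add: \<beta>_G_\<beta> W_psi signs_02 T_diag)
    finally show ?thesis
      using True by (simp add: dd_def)
  qed
  finally show ?thesis .
qed

lemma inner_\<beta>:
  assumes "j < 5"
  shows "inner \<psi> (\<beta> j \<psi>) = dd j / 17"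
proof -
  have "inner \<psi> (\<Sum>j<5. \<beta> j \<psi>) = 1"
    by (simp add: sumB unit)
  then have "(\<Sum>j<5. dd j / 4 * inner \<psi> (\<beta> 0 \<psi>)) = 1"
    unfolding inner_sum_right by (subst sum.cong[OF refl inner_\<beta>_0, symmetric]) auto
  \<comment> \<open>The entries of \<open>dd\<close> sum to 17, the trace of D^2.\<close>
  then have "inner \<psi> (\<beta> 0 \<psi>) = 4 / 17"
    by (simp add: sum_less_5 dd_def)
  then show ?thesis
    unfolding inner_\<beta>_0[OF assms] by simp
qed

lemma R_sum: "finite I \<Longrightarrow> R y (sum f I) = (\<Sum>i\<in>I. R y (f i))"
  by (induction I rule: finite_induct) (simp_all add: R_simps)

lemma L_sum: "finite I \<Longrightarrow> L y (sum f I) = (\<Sum>i\<in>I. L y (f i))"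
  by (induction I rule: finite_induct) (simp_all add: L_simps)

text \<open>E_ij E_ml vanishes unless m = j, and among the remaining E_il only E_ii has nonzero
  expectation.\<close>

lemma R_L_A:
  assumes "x < 4" "a < 5" "j < 5" "i < 5"
  shows "inner \<psi> (R i (L j (A x a \<psi>))) = uc x a j * uc x a i / (\<Sum>n<5. uc x a n * uc x a n) * dd i / 17"
proof -
  let ?n = "\<Sum>n<5. uc x a n * uc x a n"
  have RLRL: "R i (L j (R m (L l \<psi>))) = (if j = m then R i (L l \<psi>) else 0)" if "m < 5" "l < 5" for m l
    using assms that L_props[OF that(2) W_psi] by (simp add: L_R R_props R_simps)
  have "R i (L j (A x a \<psi>)) = (\<Sum>l<5. \<Sum>m<5. (uc x a m * uc x a l / ?n) *\<^sub>R R i (L j (R m (L l \<psi>))))"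
    by (subst A_RL[OF assms(1,2)]) (simp add: R_sum L_sum R_simps L_simps)
  also have "\<dots> = (\<Sum>l<5. \<Sum>m<5. of_bool (m = j) *\<^sub>R (uc x a m * uc x a l / ?n) *\<^sub>R R i (L l \<psi>))"
    by (intro sum.cong refl) (auto simp: RLRL)
  also have "\<dots> = (\<Sum>l<5. (uc x a j * uc x a l / ?n) *\<^sub>R R i (L l \<psi>))"
    by (simp only: sum_of_bool_scaleR[OF assms(3)])
  finally have "inner \<psi> (R i (L j (A x a \<psi>))) = (\<Sum>l<5. uc x a j * uc x a l / ?n * inner \<psi> (R i (L l \<psi>)))"
    by (simp add: inner_sum_right)
  also have "\<dots> = (\<Sum>l\<in>{i}. uc x a j * uc x a l / ?n * inner \<psi> (R i (L l \<psi>)))"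
    by (rule sum.mono_neutral_right) (use assms inner_RL_off in auto)
  finally show ?thesis
    using assms by (simp add: RL_diag W_psi inner_\<beta>)
qed

lemma correlation_value:
  assumes "x < 4" "y < 3" "a < 5" "b < 5"
  shows "inner \<psi> (A x a (B y b \<psi>)) =
    (\<Sum>i<5. uc x a i * wc y b i)\<^sup>2 / (17 * (\<Sum>i<5. uc x a i * uc x a i) * wnorm y b)"
proof -
  let ?n = "\<Sum>n<5. uc x a n * uc x a n"
  have "inner \<psi> (A x a (B y b \<psi>)) = inner \<psi> (B y b (A x a \<psi>))"
    by (simp add: comm)
  also have "\<dots> = (\<Sum>j<5. \<Sum>i<5. wc y b i * wc y b j / dd i / wnorm y b * inner \<psi> (R i (L j (A x a \<psi>))))"
    using B_RL[OF assms(2,4) W_I[OF Alice_A]] by (simp add: inner_sum_right)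
  \<comment> \<open>The weight \<open>dd i / 17\<close> cancels the \<open>dd i\<close> in Bob's
    coefficients, so the double sum factors.\<close>
  also have "\<dots> = (\<Sum>j<5. \<Sum>i<5. (uc x a j * wc y b j) * (uc x a i * wc y b i) * (1 / (17 * ?n * wnorm y b)))"
    using assms dd_pos by (intro sum.cong refl) (simp add: R_L_A less_imp_neq[symmetric] mult_ac)
  also have "\<dots> = (\<Sum>j<5. uc x a j * wc y b j) * (\<Sum>i<5. uc x a i * wc y b i) * (1 / (17 * ?n * wnorm y b))"
    by (simp only: sum_product) (simp only: sum_distrib_right)
  finally show ?thesis
    by (simp add: power2_eq_square)
qed

end

section \<open>Positive semidefinite matrices\<close>

definition sesq :: "complex ^ 'k ^ 'k \<Rightarrow> complex ^ 'k \<Rightarrow> complex ^ 'k \<Rightarrow> complex" where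
  "sesq A v w = (\<Sum>i\<in>UNIV. cnj (v $ i) * (A *v w) $ i)"

lemma psd_iff: "psd A \<longleftrightarrow> (\<forall>w. sesq A w w \<in> \<real>\<^sub>\<ge>\<^sub>0)"
  by (simp add: psd_def sesq_def)

lemma sesq_simps:
  "sesq A (v + v') w = sesq A v w + sesq A v' w" "sesq A (v - v') w = sesq A v w - sesq A v' w"
  "sesq A v (w + w') = sesq A v w + sesq A v w'" "sesq A v (w - w') = sesq A v w - sesq A v w'"
  by (simp_all add: sesq_def matrix_vector_right_distrib matrix_vector_mult_diff_distrib algebra_simps
      sum.distrib sum_subtractf)

lemma mult_axis: "(A *v axis k t) $ i = A $ i $ k * (t :: complex)"
proof -
  have "(A *v axis k t) $ i = (\<Sum>j\<in>{k}. A $ i $ j * axis k t $ j)"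
    unfolding matrix_vector_mult_def vec_lambda_beta
    by (rule sum.mono_neutral_right) (auto simp: axis_def)
  then show ?thesis by (simp add: axis_def)
qed

lemma sesq_axis_left: "sesq A (axis k t) w = cnj t * (A *v w) $ k"
proof -
  have "sesq A (axis k t) w = (\<Sum>i\<in>{k}. cnj (axis k t $ i) * (A *v w) $ i)"
    unfolding sesq_def by (rule sum.mono_neutral_right) (auto simp: axis_def)
  then show ?thesis by (simp add: axis_def)
qed

text \<open>The form on vectors supported on two coordinates; choices of \<open>s\<close> and
  \<open>t\<close> give the entrywise facts below.\<close>

lemma nonneg_Reals_of_axis:
  assumes "psd A"
  shows "cnj s * A $ k $ k * s + cnj s * A $ k $ i * t + (cnj t * A $ i $ k * s + cnj t * A $ i $ i * t) \<in> \<real>\<^sub>\<ge>\<^sub>0"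
proof -
  have "sesq A (axis k s + axis i t) (axis k s + axis i t) \<in> \<real>\<^sub>\<ge>\<^sub>0"
    using assms by (simp add: psd_iff)
  then show ?thesis
    by (simp add: sesq_simps sesq_axis_left mult_axis algebra_simps)
qed

lemma psd_diag:
  assumes "psd A"
  shows "A $ i $ i \<in> \<real>\<^sub>\<ge>\<^sub>0"
  using nonneg_Reals_of_axis[OF assms, of 1 i i 0] by simp

lemma psd_hermitian:
  assumes "psd A"
  shows "cnj (A $ j $ i) = A $ i $ j"
proof -
  have d: "Im (A $ i $ i) = 0" "Im (A $ j $ j) = 0"
    using psd_diag[OF assms] by (auto simp: complex_nonneg_Reals_iff)
  have "Im (A $ i $ j + A $ j $ i) = 0"
    using nonneg_Reals_of_axis[OF assms, of 1 i j 1] d by (simp add: complex_nonneg_Reals_iff)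
  moreover have "Re (A $ i $ j) - Re (A $ j $ i) = 0"
    using nonneg_Reals_of_axis[OF assms, of 1 i j \<i>] d by (simp add: complex_nonneg_Reals_iff)
  ultimately show ?thesis
    by (simp add: complex_eq_iff)
qed

lemma psd_zero_diag:
  assumes "psd A" "A $ k $ k = 0"
  shows "A $ i $ k = 0"
proof (rule ccontr)
  assume nz: "A $ i $ k \<noteq> 0"
  define r where "r = (cmod (A $ i $ k))\<^sup>2"
  have r: "r > 0" "cnj (A $ i $ k) * A $ i $ k = of_real r"
    using nz complex_norm_square[of "A $ i $ k"] by (simp_all add: r_def mult.commute)
  have ki: "A $ k $ i = cnj (A $ i $ k)"
    using psd_hermitian[OF assms(1), of i k] by simp
  \<comment> \<open>Chosen so that the form below has real part a - 2 (a + 1) with a the real part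
    of \<open>A $ i $ i\<close>, which is negative.\<close>
  define t where "t = (Re (A $ i $ i) + 1) / r"
  have "A $ i $ i - of_real (2 * t * r) \<in> \<real>\<^sub>\<ge>\<^sub>0"
  proof -
    have "cnj (- of_real t * cnj (A $ i $ k)) * A $ k $ k * (- of_real t * cnj (A $ i $ k))
        + cnj (- of_real t * cnj (A $ i $ k)) * A $ k $ i * 1
        + (cnj 1 * A $ i $ k * (- of_real t * cnj (A $ i $ k)) + cnj 1 * A $ i $ i * 1)
        = A $ i $ i - 2 * of_real t * (cnj (A $ i $ k) * A $ i $ k)"
      by (simp add: assms(2) ki algebra_simps)
    also have "\<dots> = A $ i $ i - of_real (2 * t * r)"
      unfolding r(2) by simp
    finally show ?thesis
      using nonneg_Reals_of_axis[OF assms(1), of "- of_real t * cnj (A $ i $ k)" k i 1] by (simp only:)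
  qed
  then have "Re (A $ i $ i) - 2 * t * r \<ge> 0"
    by (simp add: complex_nonneg_Reals_iff)
  moreover have "t * r = Re (A $ i $ i) + 1"
    using r by (simp add: t_def)
  moreover have "Re (A $ i $ i) \<ge> 0"
    using psd_diag[OF assms(1), of i] by (simp add: complex_nonneg_Reals_iff)
  ultimately show False
    by linarith
qed

text \<open>Completing the square in the \<open>k\<close>-th coordinate, as in the Cholesky decomposition.\<close>

lemma psd_deflate:
  assumes "psd A" "A $ k $ k \<noteq> 0"
  shows "psd (\<chi> i j. A $ i $ j - A $ i $ k * cnj (A $ j $ k) / A $ k $ k)"
  unfolding psd_iff
proof
  fix w
  let ?A' = "\<chi> i j. A $ i $ j - A $ i $ k * cnj (A $ j $ k) / A $ k $ k"
  let ?c = "(A *v w) $ k"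
  define t where "t = ?c / A $ k $ k"
  have real: "cnj (A $ k $ k) = A $ k $ k"
    by (rule psd_hermitian[OF assms(1)])
  have c: "?c = (\<Sum>j\<in>UNIV. cnj (A $ j $ k) * w $ j)"
    using psd_hermitian[OF assms(1)] by (simp add: matrix_vector_mult_def)
  have cc: "cnj ?c = (\<Sum>i\<in>UNIV. cnj (w $ i) * A $ i $ k)"
    unfolding c by (simp add: mult.commute)
  have A'w: "(?A' *v w) $ i = (A *v w) $ i - A $ i $ k * ?c / A $ k $ k" for i
  proof -
    have "(?A' *v w) $ i = (\<Sum>j\<in>UNIV. A $ i $ j * w $ j - A $ i $ k / A $ k $ k * (cnj (A $ j $ k) * w $ j))"
      unfolding matrix_vector_mult_def vec_lambda_beta by (intro sum.cong refl) (simp add: algebra_simps)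
    then show ?thesis
      unfolding c by (simp add: matrix_vector_mult_def sum_subtractf sum_distrib_left sum_divide_distrib)
  qed
  have "sesq ?A' w w = sesq A w w - cnj ?c * ?c / A $ k $ k"
  proof -
    have "sesq ?A' w w = (\<Sum>i\<in>UNIV. cnj (w $ i) * (A *v w) $ i - cnj (w $ i) * A $ i $ k * (?c / A $ k $ k))"
      unfolding sesq_def A'w by (intro sum.cong refl) (simp add: right_diff_distrib)
    also have "\<dots> = sesq A w w - cnj ?c * (?c / A $ k $ k)"
      unfolding sum_subtractf sum_distrib_right[symmetric] cc sesq_def ..
    finally show ?thesis by simp
  qed
  moreover have "sesq A w (axis k t) = cnj ?c * t"
    unfolding sesq_def cc by (simp add: mult_axis sum_distrib_left sum_distrib_right mult_ac)
  then have "sesq A (w - axis k t) (w - axis k t) = sesq A w w - cnj ?c * ?c / A $ k $ k"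
    using assms(2) real by (simp add: sesq_simps sesq_axis_left mult_axis t_def)
  ultimately show "sesq ?A' w w \<in> \<real>\<^sub>\<ge>\<^sub>0"
    using assms(1) unfolding psd_iff by metis
qed

text \<open>Induction on the set carrying the diagonal. A nonzero pivot is split off as a rank-one
  term by \<open>psd_deflate\<close>, which clears its diagonal entry and keeps the zeros outside;
  with an empty set, \<open>psd_zero_diag\<close> makes the matrix zero.\<close>

lemma psd_rank_one_sum:
  fixes A :: "complex ^ 'k ^ 'k"
  assumes "finite K" "psd A" "\<And>i. i \<notin> K \<Longrightarrow> A $ i $ i = 0"
  shows "\<exists>l :: 'k \<Rightarrow> 'k \<Rightarrow> complex. \<forall>i j. A $ i $ j = (\<Sum>k\<in>K. l k i * cnj (l k j))"
  using assms
proof (induction K arbitrary: A rule: finite_induct)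
  case empty
  then show ?case
    using psd_zero_diag[OF empty.prems(1)] by simp
next
  case (insert k K)
  show ?case
  proof (cases "A $ k $ k = 0")
    case True
    then have "A $ i $ i = 0" if "i \<notin> K" for i
      using insert.prems(2)[of i] that by (cases "i = k") auto
    then have "\<exists>l :: 'k \<Rightarrow> 'k \<Rightarrow> complex. \<forall>i j. A $ i $ j = (\<Sum>k\<in>K. l k i * cnj (l k j))"
      by (intro insert.IH insert.prems(1))
    then obtain l :: "'k \<Rightarrow> 'k \<Rightarrow> complex" where l: "\<And>i j. A $ i $ j = (\<Sum>k\<in>K. l k i * cnj (l k j))"
      by blast
    let ?l = "l(k := \<lambda>i. 0)"
    have "A $ i $ j = (\<Sum>m\<in>insert k K. ?l m i * cnj (?l m j))" for i j
    proof -
      have "(\<Sum>m\<in>K. ?l m i * cnj (?l m j)) = (\<Sum>m\<in>K. l m i * cnj (l m j))"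
        using insert.hyps by (intro sum.cong) auto
      then show ?thesis
        using insert.hyps l[of i j] by simp
    qed
    then show ?thesis
      by (intro exI[of _ ?l]) blast
  next
    case False
    let ?A' = "\<chi> i j. A $ i $ j - A $ i $ k * cnj (A $ j $ k) / A $ k $ k"
    have "?A' $ i $ i = 0" if "i \<notin> K" for i
    proof (cases "i = k")
      case True
      then show ?thesis
        using psd_hermitian[OF insert.prems(1), of k k] False by simp
    next
      case ik: False
      then have "A $ i $ i = 0" using that insert.prems(2) by auto
      moreover have "A $ k $ i = 0"
        by (rule psd_zero_diag[OF insert.prems(1) calculation])
      then have "A $ i $ k = 0"
        using psd_hermitian[OF insert.prems(1), of k i] by simp
      ultimately show ?thesis by simp
    qed
    then have "\<exists>l :: 'k \<Rightarrow> 'k \<Rightarrow> complex. \<forall>i j. ?A' $ i $ j = (\<Sum>k\<in>K. l k i * cnj (l k j))"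
      by (intro insert.IH psd_deflate insert.prems(1) False)
    then obtain l :: "'k \<Rightarrow> 'k \<Rightarrow> complex" where l: "\<And>i j. ?A' $ i $ j = (\<Sum>k\<in>K. l k i * cnj (l k j))"
      by blast
    define s where "s = complex_of_real (sqrt (Re (A $ k $ k)))"
    have s: "s * cnj s = A $ k $ k"
      using psd_diag[OF insert.prems(1), of k]
      by (simp add: s_def complex_nonneg_Reals_iff complex_eq_iff flip: of_real_mult)
    let ?l = "l(k := \<lambda>i. A $ i $ k / s)"
    have "A $ i $ j = (\<Sum>m\<in>insert k K. ?l m i * cnj (?l m j))" for i j
    proof -
      have "(\<Sum>m\<in>K. ?l m i * cnj (?l m j)) = (\<Sum>m\<in>K. l m i * cnj (l m j))"
        using insert.hyps by (intro sum.cong) auto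
      then have "(\<Sum>m\<in>insert k K. ?l m i * cnj (?l m j)) = A $ i $ k * cnj (A $ j $ k) / (s * cnj s) + ?A' $ i $ j"
        using insert.hyps l[of i j] by simp
      then show ?thesis
        by (simp add: s)
    qed
    then show ?thesis
      by (intro exI[of _ ?l]) blast
  qed
qed

section \<open>Adjoints, factorisation and the Hilbert-Schmidt inner product\<close>

definition adj :: "complex ^ 'n ^ 'm \<Rightarrow> complex ^ 'm ^ 'n" where
  "adj A = (\<chi> i j. cnj (A $ j $ i))"

lemma adj_adj [simp]: "adj (adj A) = A"
  by (simp add: adj_def vec_eq_iff)

lemma adj_mult: "adj (A ** B) = adj B ** adj A"
  by (simp add: adj_def vec_eq_iff matrix_matrix_mult_def mult.commute)

lemma psd_factor:
  fixes A :: "complex ^ 'k ^ 'k"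
  assumes "psd A"
  obtains S :: "complex ^ 'k ^ 'k" where "A = S ** adj S"
proof -
  have "\<exists>l :: 'k \<Rightarrow> 'k \<Rightarrow> complex. \<forall>i j. A $ i $ j = (\<Sum>k\<in>UNIV. l k i * cnj (l k j))"
    using assms by (intro psd_rank_one_sum) auto
  then obtain l :: "'k \<Rightarrow> 'k \<Rightarrow> complex" where "\<forall>i j. A $ i $ j = (\<Sum>k\<in>UNIV. l k i * cnj (l k j))"
    by (rule exE)
  then have "A = (\<chi> i k. l k i) ** adj (\<chi> i k. l k i)"
    by (simp add: vec_eq_iff matrix_matrix_mult_def adj_def)
  then show thesis ..
qed

lemma psd_adj: "psd A \<Longrightarrow> adj A = A"
  using psd_hermitian by (auto simp: adj_def vec_eq_iff)

lemma trace_adj_mult: "trace (adj V ** V) = of_real (inner V V)"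
proof -
  have "trace (adj V ** V) = (\<Sum>i\<in>UNIV. \<Sum>k\<in>UNIV. of_real (inner (V $ k $ i) (V $ k $ i)))"
    by (simp add: trace_def matrix_matrix_mult_def adj_def complex_eq_iff inner_complex_def)
  also have "\<dots> = (\<Sum>k\<in>UNIV. \<Sum>i\<in>UNIV. of_real (inner (V $ k $ i) (V $ k $ i)))"
    by (rule sum.swap)
  finally show ?thesis
    by (simp add: inner_vec_def)
qed

text \<open>The library inner product is the real part of the Hilbert-Schmidt product, so left
  multiplication by a Hermitian matrix is self-adjoint.\<close>

lemma inner_eq_trace: "inner V X = Re (trace (adj V ** X))"
proof -
  have "Re (trace (adj V ** X)) = (\<Sum>i\<in>UNIV. \<Sum>k\<in>UNIV. inner (V $ k $ i) (X $ k $ i))"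
    by (simp add: trace_def matrix_matrix_mult_def adj_def inner_complex_def)
  also have "\<dots> = (\<Sum>k\<in>UNIV. \<Sum>i\<in>UNIV. inner (V $ k $ i) (X $ k $ i))"
    by (rule sum.swap)
  finally show ?thesis
    by (simp add: inner_vec_def)
qed

lemma inner_mult_left: "inner (X ** V) Y = inner V (adj X ** Y)"
  by (simp add: inner_eq_trace adj_mult matrix_mul_assoc)

lemma mult_scaleR_right: "A ** (c *\<^sub>R V) = c *\<^sub>R (A ** (V :: complex ^ 'k ^ 'm))"
  by (simp add: vec_eq_iff matrix_matrix_mult_def scaleR_sum_right)

section \<open>Tensor products of operators\<close>

lemma tensor_op_mult: "tensor_op A B ** tensor_op C E = tensor_op (A ** C) (B ** E)"
  by (simp add: vec_eq_iff tensor_op_def matrix_matrix_mult_def sum_product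
      UNIV_Times_UNIV[symmetric] sum.cartesian_product case_prod_unfold mult_ac del: UNIV_Times_UNIV)

lemma adj_tensor_op: "adj (tensor_op A B) = tensor_op (adj A) (adj B)"
  by (simp add: vec_eq_iff tensor_op_def adj_def)

lemma adj_mat_1 [simp]: "adj (mat 1) = mat 1"
  by (auto simp: vec_eq_iff adj_def mat_def)

lemma tensor_op_1: "tensor_op (mat 1) (mat 1) = mat 1"
  by (auto simp: vec_eq_iff tensor_op_def mat_def prod_eq_iff)

lemma tensor_op_sum_left: "tensor_op (\<Sum>a\<in>I. A a) B = (\<Sum>a\<in>I. tensor_op (A a) B)"
  by (simp add: vec_eq_iff tensor_op_def sum_distrib_right)

lemma tensor_op_sum_right: "tensor_op B (\<Sum>a\<in>I. A a) = (\<Sum>a\<in>I. tensor_op B (A a))"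
  by (simp add: vec_eq_iff tensor_op_def sum_distrib_left)

lemma sum_mult_left: "(\<Sum>a\<in>I. A a) ** V = (\<Sum>a\<in>I. A a ** (V :: complex ^ 'k ^ 'm))"
  by (simp add: vec_eq_iff matrix_matrix_mult_def sum_distrib_right) (intro allI sum.swap)

lemma sum_mult_right: "V ** (\<Sum>a\<in>I. A a) = (\<Sum>a\<in>I. V ** (A a :: complex ^ 'k ^ 'm))"
  by (simp add: vec_eq_iff matrix_matrix_mult_def sum_distrib_left) (intro allI sum.swap)

lemma trace_sum: "trace (\<Sum>a\<in>I. A a) = (\<Sum>a\<in>I. trace (A a))"
  by (simp add: trace_def) (rule sum.swap)

text \<open>Factoring both operators gives a factor \<open>Z\<close> of their tensor product, and
  all three claims concern the squared norm of \<open>adj Z ** L\<close>.\<close>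

lemma trace_psd_tensor:
  fixes M :: "complex ^ 'm ^ 'm" and N :: "complex ^ 'n ^ 'n" and L :: "complex ^ 'k ^ ('m \<times> 'n)"
  assumes "psd M" "psd N"
  shows "trace (L ** adj L ** tensor_op M N) = of_real (inner L (tensor_op M N ** L))"
    and "inner L (tensor_op M N ** L) \<ge> 0"
    and "inner L (tensor_op M N ** L) = 0 \<Longrightarrow> tensor_op M N ** L = 0"
proof -
  obtain S :: "complex ^ 'm ^ 'm" where S: "M = S ** adj S" using psd_factor[OF assms(1)] .
  obtain S' :: "complex ^ 'n ^ 'n" where S': "N = S' ** adj S'" using psd_factor[OF assms(2)] .
  define Z where "Z = tensor_op S S'"
  have Z: "tensor_op M N = Z ** adj Z"
    by (simp add: Z_def adj_tensor_op tensor_op_mult S S')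
  have "trace (L ** adj L ** tensor_op M N) = trace (adj L ** tensor_op M N ** L)"
    by (metis matrix_mul_assoc trace_mul_sym)
  also have "\<dots> = trace (adj (adj Z ** L) ** (adj Z ** L))"
    by (simp add: Z adj_mult matrix_mul_assoc)
  finally have t: "trace (L ** adj L ** tensor_op M N) = of_real (inner (adj Z ** L) (adj Z ** L))"
    by (simp add: trace_adj_mult)
  have i: "inner L (tensor_op M N ** L) = inner (adj Z ** L) (adj Z ** L)"
    by (simp add: inner_mult_left Z matrix_mul_assoc)
  show "trace (L ** adj L ** tensor_op M N) = of_real (inner L (tensor_op M N ** L))"
    using t i by simp
  show "inner L (tensor_op M N ** L) \<ge> 0"
    unfolding i by simp
  show "tensor_op M N ** L = 0" if "inner L (tensor_op M N ** L) = 0"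
  proof -
    have "adj Z ** L = 0"
      using that unfolding i by simp
    then have "tensor_op M N ** L = Z ** 0"
      by (simp add: Z matrix_mul_assoc[symmetric])
    then show ?thesis
      by (simp add: vec_eq_iff matrix_matrix_mult_def)
  qed
qed

section \<open>The vectors of the game\<close>

lemma UNIV_5: "(UNIV :: 5 set) = {0,1,2,3,4}"
  by (rule sym, rule card_subset_eq) simp_all

lemma sum_5: "(\<Sum>i\<in>UNIV. f (i::5)) = f 0 + f 1 + f 2 + f 3 + f 4" for f :: "5 \<Rightarrow> 'a::comm_monoid_add"
  unfolding UNIV_5 by (simp add: add_ac)

lemma u_rows_uc:
  assumes "x < 4" "a < 5"
  shows "u_rows ! x ! a $ 0 = uc x a 0" "u_rows ! x ! a $ 1 = uc x a 1" "u_rows ! x ! a $ 2 = uc x a 2"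
    "u_rows ! x ! a $ 3 = uc x a 3" "u_rows ! x ! a $ 4 = uc x a 4"
proof -
  have "\<forall>x<4. \<forall>a<5. u_rows ! x ! a $ 0 = uc x a 0 \<and> u_rows ! x ! a $ 1 = uc x a 1 \<and> u_rows ! x ! a $ 2 = uc x a 2
      \<and> u_rows ! x ! a $ 3 = uc x a 3 \<and> u_rows ! x ! a $ 4 = uc x a 4"
    unfolding small_simps by (simp add: u_rows_def uc_def e_def axis_def)
  then show "u_rows ! x ! a $ 0 = uc x a 0" "u_rows ! x ! a $ 1 = uc x a 1" "u_rows ! x ! a $ 2 = uc x a 2"
    "u_rows ! x ! a $ 3 = uc x a 3" "u_rows ! x ! a $ 4 = uc x a 4"
    using assms by blast+
qed

lemmas v_defs = v_rows_def vec_c0_def vec_c1_def vec_h_def vec_h'_def vec_d0_def vec_d1_def vec_k_def vec_k'_def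

lemma v_rows_wc:
  assumes "y < 3" "b < 5"
  shows "v_rows ! y ! b $ 0 = wc y b 0 / 2" "v_rows ! y ! b $ 1 = wc y b 1 / 2" "v_rows ! y ! b $ 2 = wc y b 2 / 2"
    "v_rows ! y ! b $ 3 = wc y b 3 / 2" "v_rows ! y ! b $ 4 = wc y b 4"
proof -
  have "\<forall>y<3. \<forall>b<5. v_rows ! y ! b $ 0 = wc y b 0 / 2 \<and> v_rows ! y ! b $ 1 = wc y b 1 / 2
    \<and> v_rows ! y ! b $ 2 = wc y b 2 / 2 \<and> v_rows ! y ! b $ 3 = wc y b 3 / 2 \<and> v_rows ! y ! b $ 4 = wc y b 4"
    unfolding small_simps by (simp add: v_defs wc_def e_def axis_def)
  then show "v_rows ! y ! b $ 0 = wc y b 0 / 2" "v_rows ! y ! b $ 1 = wc y b 1 / 2" "v_rows ! y ! b $ 2 = wc y b 2 / 2"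
    "v_rows ! y ! b $ 3 = wc y b 3 / 2" "v_rows ! y ! b $ 4 = wc y b 4"
    using assms by blast+
qed

lemma D_mult: "(Defs.D *v w) $ 0 = 2 * w $ 0" "(Defs.D *v w) $ 1 = 2 * w $ 1" "(Defs.D *v w) $ 2 = 2 * w $ 2"
    "(Defs.D *v w) $ 3 = 2 * w $ 3" "(Defs.D *v w) $ 4 = w $ 4"
  by (simp_all add: D_def matrix_vector_mult_def sum_5)

lemma rows_inner:
  assumes "x < 4" "a < 5" "y < 3" "b < 5"
  shows "(u_rows ! x ! a) \<bullet> (Defs.D *v (v_rows ! y ! b)) = (\<Sum>i<5. uc x a i * wc y b i)"
  using assms by (simp add: inner_vec_def sum_5 D_mult u_rows_uc v_rows_wc sum_less_5)

lemma uDv: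
  assumes "x < 4" "a < 5" "y < 3" "b < 5"
  shows "Defs.u x a \<bullet> (Defs.D *v Defs.v y b) = (\<Sum>i<5. uc x a i * wc y b i) / (norm (u_rows ! x ! a) * norm (v_rows ! y ! b))"
  using rows_inner[OF assms]
  by (simp add: u_def v_def sgn_div_norm matrix_vector_mult_scaleR divide_inverse)

lemma p_star_eq:
  assumes "x < 4" "a < 5" "y < 3" "b < 5"
  shows "p_star a b x y = (\<Sum>i<5. uc x a i * wc y b i)\<^sup>2 / (17 * (\<Sum>i<5. uc x a i * uc x a i) * wnorm y b)"
proof -
  have "(norm (u_rows ! x ! a))\<^sup>2 = (\<Sum>i<5. uc x a i * uc x a i)"
    using assms by (simp add: power2_norm_eq_inner inner_vec_def sum_5 u_rows_uc sum_less_5)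
  moreover have "(norm (v_rows ! y ! b))\<^sup>2 = wnorm y b"
    using assms by (simp add: power2_norm_eq_inner inner_vec_def sum_5 v_rows_wc sum_less_5 wnorm_def dd_def)
  ultimately show ?thesis
    unfolding p_star_def uDv[OF assms] power2_abs power_divide power_mult_distrib by simp
qed

lemma p_wins: "x < 4 \<Longrightarrow> a < 5 \<Longrightarrow> y < 3 \<Longrightarrow> b < 5 \<Longrightarrow> (\<Sum>i<5. uc x a i * wc y b i) = 0 \<Longrightarrow> \<not> wins x y a b"
  by (simp add: wins_def uDv)

section \<open>Perfect strategies\<close>

theorem corollary2p4:
  fixes \<rho> :: "complex ^ ('m::finite \<times> 'n::finite) ^ ('m \<times> 'n)"
    and M :: "nat \<Rightarrow> nat \<Rightarrow> complex ^ 'm ^ 'm"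
    and N :: "nat \<Rightarrow> nat \<Rightarrow> complex ^ 'n ^ 'n"
  assumes "quantum_strategy \<rho> M N"
    and "winning_probability \<rho> M N = 1"
  shows "\<forall>x<4. \<forall>y<3. \<forall>a<5. \<forall>b<5.
           trace (\<rho> ** tensor_op (M x a) (N y b)) = complex_of_real (p_star a b x y)"
proof -
  have \<rho>: "psd \<rho>" "trace \<rho> = 1"
    and M: "\<And>x a. x < 4 \<Longrightarrow> a < 5 \<Longrightarrow> psd (M x a)" "\<And>x. x < 4 \<Longrightarrow> (\<Sum>a<5. M x a) = mat 1"
    and N: "\<And>y b. y < 3 \<Longrightarrow> b < 5 \<Longrightarrow> psd (N y b)" "\<And>y. y < 3 \<Longrightarrow> (\<Sum>b<5. N y b) = mat 1"
    using assms(1) by (auto simp: quantum_strategy_def density_operator_def povm5_def)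
  obtain L :: "complex ^ ('m \<times> 'n) ^ ('m \<times> 'n)" where L: "\<rho> = L ** adj L"
    using psd_factor[OF \<rho>(1)] .
  define r where "r x y a b = inner L (tensor_op (M x a) (N y b) ** L)" for x y a b
  have corr: "correlation \<rho> M N a b x y = of_real (r x y a b)" and r0: "r x y a b \<ge> 0"
    and r_eq_0: "r x y a b = 0 \<Longrightarrow> tensor_op (M x a) (N y b) ** L = 0"
    if "x < 4" "y < 3" "a < 5" "b < 5" for x y a b
    using trace_psd_tensor[OF M(1)[OF that(1,3)] N(1)[OF that(2,4)], of L]
    by (simp_all add: correlation_def r_def L)
  have r1: "(\<Sum>a<5. \<Sum>b<5. r x y a b) = 1" if "x < 4" "y < 3" for x y
  proof -
    have "complex_of_real (\<Sum>a<5. \<Sum>b<5. r x y a b) = (\<Sum>a<5. \<Sum>b<5. correlation \<rho> M N a b x y)"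
      using that by (simp add: corr)
    also have "\<dots> = trace (\<rho> ** tensor_op (\<Sum>a<5. M x a) (\<Sum>b<5. N y b))"
      by (simp add: correlation_def trace_sum sum_mult_right tensor_op_sum_left tensor_op_sum_right) (rule sum.swap)
    also have "\<dots> = 1"
      using that by (simp add: M N tensor_op_1 \<rho>)
    finally show ?thesis
      by (simp only: of_real_eq_1_iff)
  qed
  let ?w = "\<lambda>x y a b. of_bool (wins x y a b) :: real"
  have "complex_of_real ((\<Sum>x<4. \<Sum>y<3. \<Sum>a<5. \<Sum>b<5. ?w x y a b * r x y a b) / 12) = winning_probability \<rho> M N"
    unfolding winning_probability_def by (simp add: corr)
  then have "(\<Sum>x<4. \<Sum>y<3. \<Sum>a<5. \<Sum>b<5. ?w x y a b * r x y a b) / 12 = 1"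
    unfolding assms(2) by (simp only: of_real_eq_1_iff)
  \<comment> \<open>The twelve question pairs have total probability 12, and so has the winning
    part. Hence \<open>d\<close>, the losing part, is nonnegative with sum 0.\<close>
  moreover have "(\<Sum>x<4. \<Sum>y<3. \<Sum>a<5. \<Sum>b<5. r x y a b) = (\<Sum>x<4::nat. \<Sum>y<3::nat. 1)"
    by (intro sum.cong refl r1) auto
  moreover define d where "d x y a b = r x y a b - ?w x y a b * r x y a b" for x y a b
  ultimately have d_sum: "(\<Sum>x<4. \<Sum>y<3. \<Sum>a<5. \<Sum>b<5. d x y a b) = 0"
    by (simp add: sum_subtractf)
  have d0: "d x y a b \<ge> 0" if "x < 4" "y < 3" "a < 5" "b < 5" for x y a b
    using r0[OF that] by (simp add: d_def)
  have *: "d x y a b = 0" if "x < 4" "y < 3" "a < 5" "b < 5" for x y a b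
  proof -
    have "(\<Sum>y<3. \<Sum>a<5. \<Sum>b<5. d x y a b) = 0"
      using d_sum that by (intro sum_nonneg_0[where s = "{..<4}" and f = "\<lambda>x. \<Sum>y<3. \<Sum>a<5. \<Sum>b<5. d x y a b"])
        (auto intro!: sum_nonneg d0)
    then have "(\<Sum>a<5. \<Sum>b<5. d x y a b) = 0"
      using that by (intro sum_nonneg_0[where s = "{..<3}" and f = "\<lambda>y. \<Sum>a<5. \<Sum>b<5. d x y a b"])
        (auto intro!: sum_nonneg d0)
    then have "(\<Sum>b<5. d x y a b) = 0"
      using that by (intro sum_nonneg_0[where s = "{..<5}" and f = "\<lambda>a. \<Sum>b<5. d x y a b"])
        (auto intro!: sum_nonneg d0)
    then show ?thesis
      using that by (intro sum_nonneg_0[where s = "{..<5}" and f = "d x y a"]) (auto intro!: d0)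
  qed
  have lose: "tensor_op (M x a) (N y b) ** L = 0"
    if "x < 4" "y < 3" "a < 5" "b < 5" "(\<Sum>i<5. uc x a i * wc y b i) = 0" for x y a b
    using *[OF that(1-4)] p_wins[OF that(1,3,2,4,5)] by (intro r_eq_0 that) (simp add: d_def)
  \<comment> \<open>The inner product space is that of square matrices, both players act by left
    multiplication, and \<open>L\<close> is the vector \<psi>.\<close>
  interpret perfect_game "\<lambda>x a V. tensor_op (M x a) (mat 1) ** V" "\<lambda>y b V. tensor_op (mat 1) (N y b) ** V" L
  proof
    show "tensor_op (M x a) (mat 1) ** (V + V') = tensor_op (M x a) (mat 1) ** V + tensor_op (M x a) (mat 1) ** V'"
      and "tensor_op (mat 1) (N y b) ** (V + V') = tensor_op (mat 1) (N y b) ** V + tensor_op (mat 1) (N y b) ** V'"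
      for x y a b and V V' :: "complex ^ ('m \<times> 'n) ^ ('m \<times> 'n)"
      by (simp_all add: matrix_add_ldistrib)
    show "tensor_op (M x a) (mat 1) ** (c *\<^sub>R V) = c *\<^sub>R (tensor_op (M x a) (mat 1) ** V)"
      and "tensor_op (mat 1) (N y b) ** (c *\<^sub>R V) = c *\<^sub>R (tensor_op (mat 1) (N y b) ** V)"
      for x y a b c and V :: "complex ^ ('m \<times> 'n) ^ ('m \<times> 'n)"
      by (simp_all add: mult_scaleR_right)
    show "tensor_op (M x a) (mat 1) ** (tensor_op (mat 1) (N y b) ** V)
        = tensor_op (mat 1) (N y b) ** (tensor_op (M x a) (mat 1) ** V)"
      for x y a b and V :: "complex ^ ('m \<times> 'n) ^ ('m \<times> 'n)"
      by (simp add: matrix_mul_assoc tensor_op_mult)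
    show "(\<Sum>a<5. tensor_op (M x a) (mat 1) ** V) = V" if "x < 4"
      for x and V :: "complex ^ ('m \<times> 'n) ^ ('m \<times> 'n)"
      by (simp add: sum_mult_left[symmetric] tensor_op_sum_left[symmetric] M(2)[OF that] tensor_op_1)
    show "(\<Sum>b<5. tensor_op (mat 1) (N y b) ** V) = V" if "y < 3"
      for y and V :: "complex ^ ('m \<times> 'n) ^ ('m \<times> 'n)"
      by (simp add: sum_mult_left[symmetric] tensor_op_sum_right[symmetric] N(2)[OF that] tensor_op_1)
    show "inner (tensor_op (M x a) (mat 1) ** V) V' = inner V (tensor_op (M x a) (mat 1) ** V')"
      if "x < 4" "a < 5" for x a and V V' :: "complex ^ ('m \<times> 'n) ^ ('m \<times> 'n)"
      by (simp add: inner_mult_left adj_tensor_op psd_adj[OF M(1)[OF that]])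
    show "inner (tensor_op (mat 1) (N y b) ** V) V' = inner V (tensor_op (mat 1) (N y b) ** V')"
      if "y < 3" "b < 5" for y b and V V' :: "complex ^ ('m \<times> 'n) ^ ('m \<times> 'n)"
      by (simp add: inner_mult_left adj_tensor_op psd_adj[OF N(1)[OF that]])
    have "complex_of_real (inner L L) = 1"
      using \<rho>(2) unfolding trace_adj_mult[symmetric] L by (metis trace_mul_sym)
    then show "inner L L = 1"
      by (simp only: of_real_eq_1_iff)
    show "tensor_op (M x a) (mat 1) ** (tensor_op (mat 1) (N y b) ** L) = 0"
      if "x < 4" "y < 3" "a < 5" "b < 5" "(\<Sum>i<5. uc x a i * wc y b i) = 0" for x y a b
      using lose[OF that] by (simp add: matrix_mul_assoc tensor_op_mult)
  qed
  show ?thesis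
  proof (intro allI impI)
    fix x y a b :: nat assume xyab: "x < 4" "y < 3" "a < 5" "b < 5"
    have "r x y a b = inner L (tensor_op (M x a) (mat 1) ** (tensor_op (mat 1) (N y b) ** L))"
      by (simp add: r_def matrix_mul_assoc tensor_op_mult)
    also have "\<dots> = p_star a b x y"
      using correlation_value[OF xyab] p_star_eq[OF xyab(1,3,2,4)] by simp
    finally show "trace (\<rho> ** tensor_op (M x a) (N y b)) = complex_of_real (p_star a b x y)"
      using corr[OF xyab] by (simp add: correlation_def)
  qed
qed

end
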